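(* Let $k$ be a field of characteristic zero and $R=k[x_1,x_2,x_3,x_4]$. Let $b\ge a\ge 2$, let $X$ be an $a\times b$ grid on a smooth quadric surface in $\mathbb P^3$, let $d\ge b-1$ be any integer, and set $I=\Lambda_{X,d}$. Let $q,r$ be the non-negative integers such that $d=(b-1)q+r$ and $0\le r<b-1$ (so $q\ge1$). Then: (a) $[I]_t=[R]_{t-d}\cdot[I]_d$ for $d\le t\le d+q-1$; in particular, $\dim_k[I]_t=ab\cdot\binom{t-d+3}{3}$ for $d\le t\le d+q-1$; (b) $I$ has no syzygies of degree $\le q-1$; (c) $R/I$ has no socle in degree $\le d+q-2$.
   Context: $R$ has the standard grading; $[M]_t$ denotes the degree $t$ component of a graded module $M$. An $a\times b$ grid on a smooth quadric surface $\mathcal Q\subset\mathbb P^3$ is the set of $ab$ intersection points of $a$ distinct lines in one ruling of $\mathcal Q$ with $b$ distinct lines in the other ruling. The linear form dual to a point $[\alpha_1:\dots:\alpha_4]$ is $\sum\alpha_i x_i$ (up to scalar). $\Lambda_{X,d}$ is the ideal of $R$ generated by the $d$-th powers $\ell^d$ of the $ab$ linear forms $\ell$ dual to the points of $X$. In (b), the degree of a syzygy $\sum_{P} g_P\,\ell_P^d=0$ among these generators is the common degree of its homogeneous coefficients $g_P$; "no syzygies" means no nonzero ones. The socle of $R/I$ is $\{f\in R/I : x_if=0 \text{ for } i=1,\dots,4\}$.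
   Formalization: Part (c) is stated only for d ≥ 2; this excludes exactly a = b = 2, d = 1, where I = (x_1,...,x_4), so R/I = k has nonzero socle in degree 0 = d+q-2 and (c) as printed fails. *)

theory Defs
  imports
    "HOL-Analysis.Analysis"
    "HOL-Library.Poly_Mapping"
    "HOL-Algebra.Algebraic_Closure_Type"
begin

text \<open>
  A polynomial is a finitely supported function from exponent vectors to coefficients;
  the ring operations are the convolutions of \<^theory>\<open>HOL-Library.Poly_Mapping\<close>.
\<close>

type_synonym 'k poly4 = "(4 \<Rightarrow>\<^sub>0 nat) \<Rightarrow>\<^sub>0 'k"

definition Var :: "4 \<Rightarrow> 'k::field poly4" where
  "Var i = Poly_Mapping.single (Poly_Mapping.single i 1) 1"

definition Const :: "'k::field \<Rightarrow> 'k poly4" where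
  "Const c = Poly_Mapping.single 0 c"

definition mono_degree :: "(4 \<Rightarrow>\<^sub>0 nat) \<Rightarrow> nat" where
  "mono_degree m = (\<Sum>i\<in>UNIV. Poly_Mapping.lookup m i)"

definition homog :: "nat \<Rightarrow> 'k::field poly4 set" where
  "homog t = {f. \<forall>m\<in>Poly_Mapping.keys f. mono_degree m = t}"

definition scale :: "'k::field \<Rightarrow> 'k poly4 \<Rightarrow> 'k poly4" where
  "scale c f = Const c * f"

interpretation poly4: vector_space "scale :: 'k::field \<Rightarrow> 'k poly4 \<Rightarrow> 'k poly4"
  by unfold_locales
    (simp_all add: scale_def Const_def algebra_simps single_add mult_single flip: mult.assoc)

definition subspace_prod :: "'k::field poly4 set \<Rightarrow> 'k poly4 set \<Rightarrow> 'k poly4 set" where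
  "subspace_prod U V = poly4.span {f * g | f g. f \<in> U \<and> g \<in> V}"

text \<open>The ideal generated by a set is its span in $R$ as a module over itself.\<close>

definition ideal_gen :: "'k::field poly4 set \<Rightarrow> 'k poly4 set" where
  "ideal_gen S = module.span (*) S"

text \<open>This is $[I]_t$ because all ideals considered are homogeneous.\<close>

definition component :: "'k::field poly4 set \<Rightarrow> nat \<Rightarrow> 'k poly4 set" where
  "component I t = I \<inter> homog t"

text \<open>The residue class of \<open>f\<close> in $R/I$; classes are subsets of $R$.\<close>

definition residue_class :: "'k::field poly4 set \<Rightarrow> 'k poly4 \<Rightarrow> 'k poly4 set" where
  "residue_class I f = {g. g - f \<in> I}"

definition quotient_component :: "'k::field poly4 set \<Rightarrow> nat \<Rightarrow> 'k poly4 set set" where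
  "quotient_component I t = residue_class I ` homog t"

text \<open>If \<open>I\<close> is the maximal ideal $(x_1,\dots,x_4)$, then $R/I = k$ is its own socle, in degree 0.
  This happens for a $2\times 2$ grid and $d = q = 1$, where $0 = d+q-2$; hence the condition
  \<open>2 \<le> d\<close> in the socle claim of the theorem.\<close>

definition socle :: "'k::field poly4 set \<Rightarrow> 'k poly4 set set" where
  "socle I = {residue_class I f | f. \<forall>i. residue_class I (Var i * f) = residue_class I 0}"

definition eval_with :: "('k::field \<Rightarrow> 'l::field) \<Rightarrow> 'k poly4 \<Rightarrow> 'l ^ 4 \<Rightarrow> 'l" where
  "eval_with h F v =
     (\<Sum>m\<in>Poly_Mapping.keys F.
        h (Poly_Mapping.lookup F m) * (\<Prod>i\<in>UNIV. (v $ i) ^ Poly_Mapping.lookup m i))"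

text \<open>If \<open>x\<^sub>i\<close> does not occur in \<open>m\<close>, the truncated exponent below is harmless
  because the coefficient vanishes.\<close>

definition partial_deriv :: "4 \<Rightarrow> 'k::field poly4 \<Rightarrow> 'k poly4" where
  "partial_deriv i F =
     (\<Sum>m\<in>Poly_Mapping.keys F.
        Poly_Mapping.single (m - Poly_Mapping.single i 1)
          (of_nat (Poly_Mapping.lookup m i) * Poly_Mapping.lookup F m))"

text \<open>Smoothness is the Jacobian criterion at all points over the algebraic closure;
  it forces \<open>F \<noteq> 0\<close>.\<close>

definition smooth_quadric :: "'k::field poly4 \<Rightarrow> bool" where
  "smooth_quadric F \<longleftrightarrow>
     F \<in> homog 2 \<and>
     (\<forall>v :: 'k alg_closure ^ 4. v \<noteq> 0 \<and> eval_with to_ac F v = 0 \<longrightarrow>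
        (\<exists>i. eval_with to_ac (partial_deriv i F) v \<noteq> 0))"

text \<open>Linear subspaces of projective 3-space are represented by subspaces of $k^4$,
  so that incidence is inclusion.\<close>

definition proj_point :: "('k::field ^ 4) set \<Rightarrow> bool" where
  "proj_point P \<longleftrightarrow> vec.subspace P \<and> vec.dim P = 1"

definition proj_line :: "('k::field ^ 4) set \<Rightarrow> bool" where
  "proj_line L \<longleftrightarrow> vec.subspace L \<and> vec.dim L = 2"

definition on_quadric :: "'k::field poly4 \<Rightarrow> ('k ^ 4) set \<Rightarrow> bool" where
  "on_quadric F V \<longleftrightarrow> (\<forall>v\<in>V. eval_with id F v = 0)"

text \<open>A ruling is a family of lines on the quadric such that every point of the quadric lies on
  exactly one of them. A smooth quadric containing a line over \<open>k\<close> has exactly two such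
  families of lines over \<open>k\<close> (for infinite \<open>k\<close>).\<close>

definition ruling :: "'k::field poly4 \<Rightarrow> ('k ^ 4) set set \<Rightarrow> bool" where
  "ruling F \<R> \<longleftrightarrow>
     (\<forall>L\<in>\<R>. proj_line L \<and> on_quadric F L) \<and>
     (\<forall>P. proj_point P \<and> on_quadric F P \<longrightarrow> (\<exists>!L. L \<in> \<R> \<and> P \<subseteq> L))"

definition is_grid :: "nat \<Rightarrow> nat \<Rightarrow> ('k::field ^ 4) set set \<Rightarrow> bool" where
  "is_grid a b G \<longleftrightarrow>
     (\<exists>F \<R> \<R>' A B.
        smooth_quadric F \<and> ruling F \<R> \<and> ruling F \<R>' \<and> \<R> \<noteq> \<R>' \<and>
        A \<subseteq> \<R> \<and> finite A \<and> card A = a \<and>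
        B \<subseteq> \<R>' \<and> finite B \<and> card B = b \<and>
        G = {P. proj_point P \<and> (\<exists>L\<in>A. \<exists>M\<in>B. P \<subseteq> L \<and> P \<subseteq> M)})"

definition dual_form :: "'k::field ^ 4 \<Rightarrow> 'k poly4" where
  "dual_form v = (\<Sum>i\<in>UNIV. scale (v $ i) (Var i))"

text \<open>\<open>\<rho>\<close> chooses homogeneous coordinates for the points; the ideal below does not depend on
  this choice.\<close>

definition coord_choice :: "('k::field ^ 4) set set \<Rightarrow> (('k ^ 4) set \<Rightarrow> 'k ^ 4) \<Rightarrow> bool" where
  "coord_choice G \<rho> \<longleftrightarrow> (\<forall>P\<in>G. \<rho> P \<in> P \<and> \<rho> P \<noteq> 0)"

definition Lambda :: "(('k::field ^ 4) set \<Rightarrow> 'k ^ 4) \<Rightarrow> ('k ^ 4) set set \<Rightarrow> nat \<Rightarrow> 'k poly4 set" where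
  "Lambda \<rho> G d = ideal_gen {dual_form (\<rho> P) ^ d | P. P \<in> G}"

end

theory Submission
  imports Defs
begin

text \<open>
  Each point \<open>P\<close> of the grid is avoided by \<open>b - 1\<close> tangent planes that together contain all other
  points. A relation \<open>\<Sum> g\<^sub>P \<ell>\<^sub>P\<^sup>d = 0\<close> with \<open>g\<^sub>P\<close> of degree less than \<open>n\<close>, where \<open>n (b - 1) \<le> d\<close>, is
  differentiated \<open>n\<close> times along each of the corresponding directions: this kills every summand
  except that of \<open>P\<close>, on which it acts injectively. So there are no syzygies, and (a) and (b) follow.

  For (c), let all \<open>x\<^sub>i f\<close> lie in the ideal, and let \<open>\<Delta>\<close> be the second order operator whose symbol
  is the quadric. As the quadric vanishes at the points, \<open>\<Delta>\<close> lowers by one both the exponent and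
  the degrees of the coefficients in \<open>\<Sum> g\<^sub>P \<ell>\<^sub>P\<^sup>e\<close>. The commutator of a power of \<open>\<Delta>\<close> with \<open>x\<^sub>i\<close> gives
  the derivatives of the next lower power of \<open>\<Delta>\<close> applied to \<open>f\<close>, and these can be integrated because
  there are no syzygies; this descends to \<open>f\<close> itself. The one remaining case is \<open>b = 2\<close> in the top
  degree, where the ideal is generated by powers of four independent linear forms.
\<close>

text \<open>A tangent plane at a grid point contains two lines of the quadric, one from each ruling.
  On each of the \<open>b - 1\<close> lines of the larger family that miss \<open>P\<close> one grid
  point is picked, so that every line of the smaller family missing \<open>P\<close> is used too; a
  - 1 \<le> b - 1 makes this possible. One round of derivatives along the normals of these planes
  costs at most \<open>b - 1\<close> in each exponent and lowers the degree of every coefficient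
  except that of \<open>P\<close>, whence n (b - 1) \<le> d.

  In (c) integration compares mixed second derivatives. Let \<open>m - 1\<close> be the degree of
  the coefficients of the multiples of \<open>f\<close> by variables, so m \<le> q. For the
  \<open>k\<close>-th power of \<Delta>, uniqueness is needed at exponent d - k - 2 with
  coefficients of degree below m - 1 - k, that is (m - 1 - k) (b - 1) + k + 2 \<le> d. When b \<ge>
  3 this follows from m (b - 1) \<le> d, as (k + 1) (b - 1) \<ge> k + 2. When b = 2 it reads m + 1
  \<le> d and fails only for m = q = d, the remaining case.\<close>

lemma poly_mapping_monomial_induct [case_names zero single add]:
  fixes f :: "'a \<Rightarrow>\<^sub>0 'b::comm_monoid_add"
  assumes "P 0" "\<And>m c. P (Poly_Mapping.single m c)" "\<And>f g. P f \<Longrightarrow> P g \<Longrightarrow> P (f + g)"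
  shows "P f"
proof (induction f rule: update_induct)
  case const
  show ?case by (rule assms(1))
next
  case (update f a b)
  have "Poly_Mapping.update a b f = Poly_Mapping.single a b + f"
    using update(1)
    by (intro poly_mapping_eqI) (auto simp: lookup_update lookup_add lookup_single when_def in_keys_iff)
  with assms(2,3) update(3) show ?case by simp
qed

lemma poly_mapping_sum_singles:
  "(\<Sum>m\<in>Poly_Mapping.keys f. Poly_Mapping.single m (Poly_Mapping.lookup f m)) = f"
  by (intro poly_mapping_eqI) (auto simp: lookup_sum lookup_single when_def in_keys_iff)

subsection \<open>Derivations\<close>

text \<open>Terms may cancel, so the keys of a sum need not be the union of the keys of the
  summands; additivity is checked over a common finite set of exponents.\<close>

lemma partial_deriv_eq_sum:
  assumes "finite S" "Poly_Mapping.keys F \<subseteq> S"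
  shows "partial_deriv i F = (\<Sum>m\<in>S. Poly_Mapping.single (m - Poly_Mapping.single i 1)
          (of_nat (Poly_Mapping.lookup m i) * Poly_Mapping.lookup F m))"
  unfolding partial_deriv_def using assms by (intro sum.mono_neutral_left) (auto simp: in_keys_iff)

lemma partial_deriv_zero [simp]: "partial_deriv i 0 = 0"
  by (simp add: partial_deriv_def)

lemma partial_deriv_single:
  "partial_deriv i (Poly_Mapping.single m c) =
     Poly_Mapping.single (m - Poly_Mapping.single i 1) (of_nat (Poly_Mapping.lookup m i) * c)"
  by (subst partial_deriv_eq_sum[of "{m}"]) auto

lemma partial_deriv_add: "partial_deriv i (f + g) = partial_deriv i f + partial_deriv i g"
proof -
  let ?S = "Poly_Mapping.keys f \<union> Poly_Mapping.keys g"
  have "partial_deriv i h = (\<Sum>m\<in>?S. Poly_Mapping.single (m - Poly_Mapping.single i 1)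
          (of_nat (Poly_Mapping.lookup m i) * Poly_Mapping.lookup h m))" if "h \<in> {f, g, f + g}" for h
    using that keys_add[of f g] by (intro partial_deriv_eq_sum) auto
  then show ?thesis
    by (simp add: lookup_add distrib_left single_add sum.distrib)
qed

lemma partial_deriv_mult:
  "partial_deriv i (f * g) = partial_deriv i f * g + f * partial_deriv i g"
proof (induction f rule: poly_mapping_monomial_induct)
  case (single m a)
  show ?case
  proof (induction g rule: poly_mapping_monomial_induct)
    case (single n b)
    let ?e = "Poly_Mapping.single i (Suc 0) :: 4 \<Rightarrow>\<^sub>0 nat"
    \<comment> \<open>Exponent subtraction is truncated, so a unit can be moved across the sum only
      if the variable occurs in \<open>k\<close>; where it does not, the factor
      \<open>of_nat 0\<close> removes the term.\<close>
    have shift: "k - ?e + l = k + l - ?e" if "Poly_Mapping.lookup k i \<noteq> 0" for k l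
      using that by (intro poly_mapping_eqI) (auto simp: lookup_add lookup_minus lookup_single when_def)
    have 1: "partial_deriv i (Poly_Mapping.single m a) * Poly_Mapping.single n b =
        Poly_Mapping.single (m + n - ?e) (of_nat (Poly_Mapping.lookup m i) * a * b)"
      by (cases "Poly_Mapping.lookup m i = 0") (auto simp: partial_deriv_single mult_single shift)
    have 2: "Poly_Mapping.single m a * partial_deriv i (Poly_Mapping.single n b) =
        Poly_Mapping.single (m + n - ?e) (of_nat (Poly_Mapping.lookup n i) * a * b)"
      using shift[of n m]
      by (cases "Poly_Mapping.lookup n i = 0")
        (auto simp: partial_deriv_single mult_single add.commute mult_ac)
    show ?case
      unfolding 1 2 by (simp add: mult_single partial_deriv_single lookup_add algebra_simps
          flip: single_add)
  qed (auto simp: partial_deriv_add algebra_simps)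
qed (auto simp: partial_deriv_add algebra_simps)

lemma partial_deriv_Const [simp]: "partial_deriv i (Const c) = 0"
  by (simp add: Const_def partial_deriv_single)

lemma partial_deriv_Var: "partial_deriv i (Var j) = of_bool (i = j)"
  by (auto simp: Var_def partial_deriv_single lookup_single when_def)

lemma Var_nonzero [simp]: "Var i \<noteq> 0"
  by (metis of_bool_eq(2) partial_deriv_Var partial_deriv_zero zero_neq_one)

lemma partial_deriv_sum: "partial_deriv i (\<Sum>x\<in>A. f x) = (\<Sum>x\<in>A. partial_deriv i (f x))"
  by (induction A rule: infinite_finite_induct) (auto simp: partial_deriv_add)

lemma partial_deriv_Const_mult: "partial_deriv i (Const c * f) = Const c * partial_deriv i f"
  by (simp add: partial_deriv_mult)

lemma Const_0 [simp]: "Const 0 = 0"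
  and Const_1 [simp]: "Const 1 = 1"
  and Const_add: "Const (x + y) = Const x + Const y"
  and Const_mult: "Const (x * y) = Const x * Const y"
  by (simp_all add: Const_def single_add mult_single)

lemma Const_of_nat: "Const (of_nat n) = of_nat n"
  by (induction n) (simp_all add: Const_add)

lemma Const_sum: "Const (\<Sum>x\<in>A. f x) = (\<Sum>x\<in>A. Const (f x))"
  by (induction A rule: infinite_finite_induct) (auto simp: Const_add)

lemma Const_eq_0_iff [simp]: "Const c = 0 \<longleftrightarrow> c = 0"
  unfolding Const_def by (metis lookup_single_eq lookup_zero single_zero)

lemma Const_inverse_mult_cancel: "c \<noteq> 0 \<Longrightarrow> Const (inverse c) * (Const c * f) = f"
  by (metis Const_1 Const_mult left_inverse mult.assoc mult_1)

lemma partial_deriv_commute: "partial_deriv i (partial_deriv j f) = partial_deriv j (partial_deriv i f)"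
proof (induction f rule: poly_mapping_monomial_induct)
  case (single m c)
  have "m - Poly_Mapping.single i 1 - Poly_Mapping.single j 1 =
      m - Poly_Mapping.single j 1 - Poly_Mapping.single i (1::nat)"
    by (intro poly_mapping_eqI) (auto simp: lookup_minus)
  then show ?case
    by (cases "i = j") (simp_all add: partial_deriv_single lookup_minus lookup_single mult_ac)
qed (auto simp: partial_deriv_add)

section \<open>Directional derivatives and linear forms\<close>

definition dir_deriv :: "'k::field ^ 4 \<Rightarrow> 'k poly4 \<Rightarrow> 'k poly4" where
  "dir_deriv v f = (\<Sum>i\<in>UNIV. Const (v $ i) * partial_deriv i f)"

lemma dir_deriv_zero [simp]: "dir_deriv v 0 = 0"
  and dir_deriv_Const [simp]: "dir_deriv v (Const c) = 0"
  by (simp_all add: dir_deriv_def)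

lemma dir_deriv_add: "dir_deriv v (f + g) = dir_deriv v f + dir_deriv v g"
  by (simp add: dir_deriv_def partial_deriv_add distrib_left sum.distrib)

lemma dir_deriv_sum: "dir_deriv v (\<Sum>x\<in>A. f x) = (\<Sum>x\<in>A. dir_deriv v (f x))"
  by (induction A rule: infinite_finite_induct) (auto simp: dir_deriv_add)

lemma dir_deriv_mult: "dir_deriv v (f * g) = dir_deriv v f * g + f * dir_deriv v g"
  by (simp add: dir_deriv_def partial_deriv_mult sum_distrib_left sum_distrib_right
      sum.distrib algebra_simps)

lemma dir_deriv_Const_mult: "dir_deriv v (Const c * f) = Const c * dir_deriv v f"
  by (simp add: dir_deriv_mult)

lemma dir_deriv_axis: "dir_deriv (axis i 1) = partial_deriv i"
proof
  fix f :: "'a poly4"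
  have "dir_deriv (axis i 1) f = (\<Sum>j\<in>UNIV. if j = i then partial_deriv j f else 0)"
    unfolding dir_deriv_def by (intro sum.cong) (auto simp: axis_def)
  then show "dir_deriv (axis i 1) f = partial_deriv i f" by simp
qed

lemma dir_deriv_partial_deriv_commute:
  "dir_deriv v (partial_deriv i f) = partial_deriv i (dir_deriv v f)"
  by (simp add: dir_deriv_def partial_deriv_sum partial_deriv_Const_mult partial_deriv_commute[of i])

lemma dir_deriv_commute: "dir_deriv v (dir_deriv w f) = dir_deriv w (dir_deriv v f)"
  by (simp add: dir_deriv_def[of w] dir_deriv_sum dir_deriv_Const_mult dir_deriv_partial_deriv_commute)

lemma dir_deriv_power_Suc: "dir_deriv v (f ^ Suc n) = of_nat (Suc n) * dir_deriv v f * f ^ n"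
  by (induction n) (simp_all add: dir_deriv_mult algebra_simps)

definition pairing :: "'k::field ^ 4 \<Rightarrow> 'k ^ 4 \<Rightarrow> 'k" where
  "pairing v w = (\<Sum>i\<in>UNIV. v $ i * w $ i)"

lemma dual_form_eq: "dual_form v = (\<Sum>i\<in>UNIV. Const (v $ i) * Var i)"
  by (simp add: dual_form_def scale_def)

lemma dir_deriv_Var: "dir_deriv v (Var i) = Const (v $ i)"
  by (simp add: dir_deriv_def partial_deriv_Var of_bool_def if_distrib[of "\<lambda>x. _ * x"] cong: if_cong)

lemma dir_deriv_dual_form: "dir_deriv v (dual_form w) = Const (pairing v w)"
  by (simp add: dual_form_eq dir_deriv_sum dir_deriv_Const_mult dir_deriv_Var pairing_def
      Const_sum flip: Const_mult) (simp add: mult.commute)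

lemma pairing_axis: "pairing (axis i 1) v = v $ i"
proof -
  have "pairing (axis i 1) v = (\<Sum>j\<in>UNIV. if j = i then v $ j else 0)"
    unfolding pairing_def by (intro sum.cong) (auto simp: axis_def)
  then show ?thesis by simp
qed

lemma dual_form_eq_0_iff: "dual_form v = 0 \<longleftrightarrow> v = 0"
proof
  assume "dual_form v = 0"
  then have "Const (v $ i) = 0" for i
    using dir_deriv_dual_form[of "axis i 1" v] by (simp add: pairing_axis)
  then show "v = 0"
    by (simp add: vec_eq_iff)
qed (simp add: dual_form_eq)

subsection \<open>Homogeneous polynomials\<close>

text \<open>The index is the degree plus one, so that differentiating a constant stays in the family.\<close>

definition homog_pred :: "nat \<Rightarrow> 'k::field poly4 set" where
  "homog_pred n = {f. \<forall>m\<in>Poly_Mapping.keys f. Suc (mono_degree m) = n}"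

lemma homog_pred_Suc [simp]: "homog_pred (Suc t) = homog t"
  by (simp add: homog_pred_def homog_def)

lemma homog_pred_0 [simp]: "homog_pred 0 = {0}"
  by (auto simp: homog_pred_def)

lemma homog_pred_zero [simp]: "0 \<in> homog_pred n"
  by (simp add: homog_pred_def)

lemma homog_zero [simp]: "0 \<in> homog t"
  by (simp add: homog_def)

lemma homog_pred_add: "f \<in> homog_pred n \<Longrightarrow> g \<in> homog_pred n \<Longrightarrow> f + g \<in> homog_pred n"
  using keys_add[of f g] by (auto simp: homog_pred_def)

lemma homog_pred_sum: "(\<And>x. x \<in> A \<Longrightarrow> f x \<in> homog_pred n) \<Longrightarrow> (\<Sum>x\<in>A. f x) \<in> homog_pred n"
  by (induction A rule: infinite_finite_induct) (auto intro: homog_pred_add)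

lemma homog_sum: "(\<And>x. x \<in> A \<Longrightarrow> f x \<in> homog t) \<Longrightarrow> (\<Sum>x\<in>A. f x) \<in> homog t"
  using homog_pred_sum[of A f "Suc t"] by simp

lemma mono_degree_add: "mono_degree (m + n) = mono_degree m + mono_degree n"
  by (simp add: mono_degree_def lookup_add sum.distrib)

lemma mono_degree_single [simp]: "mono_degree (Poly_Mapping.single i n) = n"
  by (simp add: mono_degree_def lookup_single when_def)

lemma mono_degree_zero [simp]: "mono_degree 0 = 0"
  by (simp add: mono_degree_def)

lemma homog_mult_pred:
  assumes "f \<in> homog s" "g \<in> homog_pred n"
  shows "f * g \<in> homog_pred (s + n)"
  using assms keys_mult[of f g] by (fastforce simp: homog_def homog_pred_def mono_degree_add)

lemma homog_mult: "f \<in> homog s \<Longrightarrow> g \<in> homog t \<Longrightarrow> f * g \<in> homog (s + t)"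
  using homog_mult_pred[of f s g "Suc t"] by simp

lemma Const_homog [simp]: "Const c \<in> homog 0"
  by (simp add: Const_def homog_def)

lemma one_homog [simp]: "1 \<in> homog 0"
  using Const_homog[of 1] by simp

lemma Var_homog: "Var i \<in> homog 1"
  by (simp add: Var_def homog_def)

lemma homog_pred_Const_mult: "g \<in> homog_pred n \<Longrightarrow> Const c * g \<in> homog_pred n"
  using homog_mult_pred[of "Const c" 0] by simp

lemma homog_Const_mult: "g \<in> homog t \<Longrightarrow> Const c * g \<in> homog t"
  using homog_pred_Const_mult[of g "Suc t"] by simp

lemma homog_pred_of_nat_mult: "g \<in> homog_pred n \<Longrightarrow> of_nat c * g \<in> homog_pred n"
  using homog_pred_Const_mult[of g n "of_nat c"] by (simp add: Const_of_nat)

lemma homog_pred_uminus: "g \<in> homog_pred n \<Longrightarrow> - g \<in> homog_pred n"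
  by (simp add: homog_pred_def)

lemma homog_pred_diff: "f \<in> homog_pred n \<Longrightarrow> g \<in> homog_pred n \<Longrightarrow> f - g \<in> homog_pred n"
  using homog_pred_add[OF _ homog_pred_uminus, of f n g] by simp

lemma homog_pred_Var_mult: "g \<in> homog_pred n \<Longrightarrow> Var i * g \<in> homog_pred (Suc n)"
  using homog_mult_pred[OF Var_homog] by fastforce

lemma dual_form_homog: "dual_form v \<in> homog 1"
  unfolding dual_form_eq by (intro homog_sum homog_Const_mult Var_homog)

lemma homog_power: "f \<in> homog s \<Longrightarrow> f ^ n \<in> homog (n * s)"
  by (induction n) (auto dest: homog_mult)

lemma dual_form_power_homog: "dual_form v ^ n \<in> homog n"
  using homog_power[OF dual_form_homog] by force

lemma partial_deriv_homog_pred: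
  assumes "f \<in> homog_pred n"
  shows "partial_deriv i f \<in> homog_pred (n - 1)"
proof -
  have "Poly_Mapping.single (m - Poly_Mapping.single i 1)
      (of_nat (Poly_Mapping.lookup m i) * Poly_Mapping.lookup f m) \<in> homog_pred (n - 1)"
    if "m \<in> Poly_Mapping.keys f" for m
  proof (cases "Poly_Mapping.lookup m i = 0")
    case False
    then have "m = (m - Poly_Mapping.single i 1) + Poly_Mapping.single i 1"
      by (intro poly_mapping_eqI) (auto simp: lookup_add lookup_minus lookup_single when_def)
    then have "mono_degree m = mono_degree (m - Poly_Mapping.single i 1) + 1"
      by (metis mono_degree_add mono_degree_single)
    with that assms show ?thesis by (auto simp: homog_pred_def)
  qed simp
  then show ?thesis
    unfolding partial_deriv_def by (intro homog_pred_sum) auto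
qed

lemma dir_deriv_homog_pred: "f \<in> homog_pred n \<Longrightarrow> dir_deriv v f \<in> homog_pred (n - 1)"
  unfolding dir_deriv_def by (intro homog_pred_sum homog_pred_Const_mult partial_deriv_homog_pred)

lemma homog_0_eq_Const:
  assumes "f \<in> homog 0"
  obtains c where "f = Const c"
proof
  have "m = 0" if "m \<in> Poly_Mapping.keys f" for m
    using that assms by (intro poly_mapping_eqI) (auto simp: homog_def mono_degree_def)
  then show "f = Const (Poly_Mapping.lookup f 0)"
    by (intro poly_mapping_eqI) (auto simp: Const_def lookup_single when_def in_keys_iff)
qed

text \<open>Checked on monomials: multiplying by the variable restores its exponent, and the
  exponents add up to \<open>t\<close>. In characteristic zero this recovers a form of positive
  degree from its derivatives.\<close>

lemma euler:
  assumes "f \<in> homog t"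
  shows "(\<Sum>i\<in>UNIV. Var i * partial_deriv i f) = of_nat t * f"
proof -
  have monom: "Var i * Poly_Mapping.single (m - Poly_Mapping.single i 1) (of_nat (Poly_Mapping.lookup m i) * c)
      = Const (of_nat (Poly_Mapping.lookup m i)) * Poly_Mapping.single m c"
    for i m and c :: 'a
  proof (cases "Poly_Mapping.lookup m i = 0")
    case False
    then have "Poly_Mapping.single i 1 + (m - Poly_Mapping.single i 1) = m"
      by (intro poly_mapping_eqI) (auto simp: lookup_add lookup_minus lookup_single when_def)
    then show ?thesis by (simp add: Var_def Const_def mult_single del: single_of_nat)
  qed simp
  have "(\<Sum>i\<in>UNIV. Var i * partial_deriv i f) = (\<Sum>m\<in>Poly_Mapping.keys f.
      \<Sum>i\<in>UNIV. Const (of_nat (Poly_Mapping.lookup m i)) * Poly_Mapping.single m (Poly_Mapping.lookup f m))"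
    unfolding partial_deriv_def sum_distrib_left monom by (rule sum.swap)
  also have "\<dots> = (\<Sum>m\<in>Poly_Mapping.keys f. of_nat t * Poly_Mapping.single m (Poly_Mapping.lookup f m))"
    using assms by (intro sum.cong) (auto simp: homog_def mono_degree_def Const_of_nat simp flip: sum_distrib_right of_nat_sum)
  also have "\<dots> = of_nat t * (\<Sum>m\<in>Poly_Mapping.keys f. Poly_Mapping.single m (Poly_Mapping.lookup f m))"
    by (simp add: sum_distrib_left)
  finally show ?thesis
    by (simp add: poly_mapping_sum_singles)
qed

lemma homog_partial_derivs_zero:
  fixes f :: "'k::field_char_0 poly4"
  assumes "f \<in> homog t" "t > 0" "\<And>i. partial_deriv i f = 0"
  shows "f = 0"
  using euler[OF assms(1)] assms(2,3) by (simp flip: Const_of_nat)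

subsection \<open>Combinations of powers of linear forms\<close>

text \<open>The product rule with the common factor \<open>dual_form w ^ e\<close> taken out: the
  exponent drops by one, and the bracket is a new coefficient in the same degree as
  \<open>g\<close>.\<close>

lemma dir_deriv_mult_power:
  "dir_deriv h (g * dual_form w ^ Suc e) =
     (dir_deriv h g * dual_form w + of_nat (Suc e) * Const (pairing h w) * g) * dual_form w ^ e"
  unfolding dir_deriv_mult dir_deriv_power_Suc dir_deriv_dual_form by (simp add: algebra_simps)

text \<open>A direction orthogonal to \<open>w\<close> treats the power as a constant: the exponent
  survives, and the coefficient loses a degree instead.\<close>

lemma dir_deriv_mult_power_zero:
  assumes "pairing h w = 0"
  shows "dir_deriv h (g * dual_form w ^ e) = dir_deriv h g * dual_form w ^ e"
  using assms by (cases e) (simp_all only: dir_deriv_mult_power, simp_all add: algebra_simps)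

lemma homog_pred_dir_deriv_mult_form:
  assumes "g \<in> homog_pred n"
  shows "dir_deriv h g * dual_form w \<in> homog_pred n"
proof (cases n)
  case (Suc k)
  then show ?thesis
    using homog_mult_pred[OF dual_form_homog dir_deriv_homog_pred[OF assms]] by (simp add: mult.commute)
qed (use assms in simp)

lemma homog_pred_twisted:
  assumes "g \<in> homog_pred n"
  shows "dir_deriv h g * dual_form w + of_nat e * Const c * g \<in> homog_pred n"
  using assms homog_pred_of_nat_mult[OF homog_pred_Const_mult[OF assms]]
  by (intro homog_pred_add homog_pred_dir_deriv_mult_form) (auto simp: mult.assoc)

text \<open>Differentiating the equation reproduces it for \<open>dir_deriv h g\<close> with \<open>e + 1\<close> in place of \<open>e\<close>.\<close>

lemma twisted_deriv_injective:
  fixes g :: "'k::field_char_0 poly4"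
  assumes "g \<in> homog_pred n" "e > 0" "pairing h w \<noteq> 0"
    and "dir_deriv h g * dual_form w + of_nat e * Const (pairing h w) * g = 0"
  shows "g = 0"
  using assms
proof (induction n arbitrary: g e)
  case (Suc n)
  have "dir_deriv h (dir_deriv h g * dual_form w + of_nat e * Const (pairing h w) * g) = 0"
    using Suc.prems(4) by simp
  then have "dir_deriv h (dir_deriv h g) * dual_form w
      + of_nat (Suc e) * Const (pairing h w) * dir_deriv h g = 0"
    by (simp add: dir_deriv_add dir_deriv_mult dir_deriv_dual_form Const_add algebra_simps flip: Const_of_nat)
  moreover have "dir_deriv h g \<in> homog_pred n"
    using dir_deriv_homog_pred[OF Suc.prems(1)] by simp
  ultimately have "dir_deriv h g = 0"
    using Suc.IH[of "dir_deriv h g" "Suc e"] Suc.prems(3) by simp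
  then show ?case
    using Suc.prems by (simp flip: Const_of_nat)
qed simp

section \<open>Iterated derivatives and the absence of syzygies\<close>

lemma fold_dir_deriv_zero [simp]: "fold dir_deriv hs 0 = 0"
  by (induction hs) auto

lemma fold_dir_deriv_add: "fold dir_deriv hs (f + g) = fold dir_deriv hs f + fold dir_deriv hs g"
  by (induction hs arbitrary: f g) (auto simp: dir_deriv_add)

lemma fold_dir_deriv_sum: "fold dir_deriv hs (\<Sum>x\<in>A. f x) = (\<Sum>x\<in>A. fold dir_deriv hs (f x))"
  by (induction A rule: infinite_finite_induct) (auto simp: fold_dir_deriv_add)

text \<open>No direction is orthogonal to \<open>w\<close>, so every step replaces the coefficient
  injectively, by \<open>twisted_deriv_injective\<close>; a nonzero coefficient stays nonzero as
  long as the exponent lasts.\<close>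

lemma fold_dir_deriv_mult_power:
  fixes g :: "'k::field_char_0 poly4"
  assumes "g \<in> homog_pred n" "length hs \<le> e" "\<forall>h\<in>set hs. pairing h w \<noteq> 0"
  shows "\<exists>g'. fold dir_deriv hs (g * dual_form w ^ e) = g' * dual_form w ^ (e - length hs)
           \<and> (g' = 0 \<longrightarrow> g = 0)"
  using assms
proof (induction hs arbitrary: g e)
  case (Cons h hs)
  then obtain e' where e: "e = Suc e'" by (cases e) auto
  let ?g = "dir_deriv h g * dual_form w + of_nat e * Const (pairing h w) * g"
  have "?g = 0 \<longrightarrow> g = 0"
    using twisted_deriv_injective[OF Cons.prems(1), of e h w] Cons.prems(3) e by simp
  moreover have "\<exists>g'. fold dir_deriv hs (?g * dual_form w ^ e') = g' * dual_form w ^ (e' - length hs)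
           \<and> (g' = 0 \<longrightarrow> ?g = 0)"
    using Cons.prems e by (intro Cons.IH homog_pred_twisted) auto
  ultimately show ?case
    by (auto simp add: dir_deriv_mult_power e simp del: power_Suc of_nat_Suc)
qed auto

text \<open>The exponent is bounded only from below: a direction orthogonal to \<open>w\<close>
  leaves it alone, while any other lowers it by one.\<close>

definition power_multiples :: "'k::field ^ 4 \<Rightarrow> nat \<Rightarrow> nat \<Rightarrow> 'k poly4 set" where
  "power_multiples w n c = {g * dual_form w ^ e | g e. g \<in> homog_pred n \<and> c \<le> e}"

lemma dir_deriv_power_multiples:
  assumes "f \<in> power_multiples w n (Suc c)"
  shows "dir_deriv h f \<in> power_multiples w n c"
    and "pairing h w = 0 \<Longrightarrow> dir_deriv h f \<in> power_multiples w (n - 1) c"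
proof -
  obtain g e where f: "f = g * dual_form w ^ e" and g: "g \<in> homog_pred n" and "Suc c \<le> e"
    using assms by (auto simp: power_multiples_def)
  then obtain e' where e: "e = Suc e'" "c \<le> e'" by (cases e) auto
  show "dir_deriv h f \<in> power_multiples w n c"
    unfolding f e dir_deriv_mult_power power_multiples_def using homog_pred_twisted[OF g] e by blast
  show "dir_deriv h f \<in> power_multiples w (n - 1) c" if "pairing h w = 0"
    unfolding f dir_deriv_mult_power_zero[OF that] power_multiples_def
    using dir_deriv_homog_pred[OF g] \<open>c \<le> e'\<close> e(1) le_SucI by blast
qed

lemma fold_dir_deriv_power_multiples:
  assumes "f \<in> power_multiples w n (length hs + c)"
  shows "fold dir_deriv hs f \<in> power_multiples w n c"
  using assms by (induction hs arbitrary: f) (auto intro: dir_deriv_power_multiples(1))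

text \<open>The first direction orthogonal to \<open>w\<close> takes a degree from the coefficient;
  the others cost at most one exponent each.\<close>

lemma fold_dir_deriv_power_multiples_zero:
  assumes "f \<in> power_multiples w n (length hs + c)" "\<exists>h\<in>set hs. pairing h w = 0"
  shows "fold dir_deriv hs f \<in> power_multiples w (n - 1) c"
  using assms
proof (induction hs arbitrary: f)
  case (Cons h hs)
  have f: "f \<in> power_multiples w n (Suc (length hs + c))" using Cons.prems by simp
  show ?case
  proof (cases "pairing h w = 0")
    case True
    then show ?thesis
      using fold_dir_deriv_power_multiples[OF dir_deriv_power_multiples(2)[OF f]] by simp
  next
    case False
    then show ?thesis
      using Cons.IH[OF dir_deriv_power_multiples(1)[OF f]] Cons.prems by simp
  qed
qed simp

text \<open>Each pass through \<open>hs\<close> lowers the index \<open>n\<close> by one and the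
  exponent bound by \<open>length hs\<close>; at index 0 only the zero polynomial is left.\<close>

lemma fold_dir_deriv_replicate_zero:
  assumes "f \<in> power_multiples w n (n * length hs)" "\<exists>h\<in>set hs. pairing h w = 0"
  shows "fold dir_deriv (concat (replicate n hs)) f = 0"
  using assms
proof (induction n arbitrary: f)
  case 0
  then show ?case by (auto simp: power_multiples_def)
next
  case (Suc n)
  then show ?case
    using fold_dir_deriv_power_multiples_zero[of f w "Suc n" hs "n * length hs"]
    by (simp add: add.commute)
qed

text \<open>The hyperplanes dual to a list of vectors cover all points but one and avoid that one.\<close>

definition separates :: "'a set \<Rightarrow> ('a \<Rightarrow> 'k::field ^ 4) \<Rightarrow> nat \<Rightarrow> bool" where
  "separates S p c \<longleftrightarrow> (\<forall>P\<in>S. \<exists>hs. length hs = c \<and> (\<forall>h\<in>set hs. pairing h (p P) \<noteq> 0) \<and>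
     (\<forall>Q\<in>S. Q \<noteq> P \<longrightarrow> (\<exists>h\<in>set hs. pairing h (p Q) = 0)))"

lemma power_comb_unique:
  fixes p :: "'a \<Rightarrow> 'k::field_char_0 ^ 4"
  assumes "finite S" "separates S p c" "n * c \<le> e" "\<forall>P\<in>S. g P \<in> homog_pred n"
    and "\<forall>P\<in>S. p P \<noteq> 0"
    and "(\<Sum>P\<in>S. g P * dual_form (p P) ^ e) = 0" "P \<in> S"
  shows "g P = 0"
proof -
  obtain hs where hs: "length hs = c" "\<forall>h\<in>set hs. pairing h (p P) \<noteq> 0"
    "\<forall>Q\<in>S. Q \<noteq> P \<longrightarrow> (\<exists>h\<in>set hs. pairing h (p Q) = 0)"
    using assms(2,7) by (auto simp: separates_def)
  let ?hs = "concat (replicate n hs)"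
  have len: "length ?hs = n * c" by (induction n) (use hs in auto)
  have "fold dir_deriv ?hs (g Q * dual_form (p Q) ^ e) = 0" if "Q \<in> S" "Q \<noteq> P" for Q
    using that assms(3,4) hs
    by (intro fold_dir_deriv_replicate_zero) (auto simp: power_multiples_def)
  then have "(\<Sum>Q\<in>S. fold dir_deriv ?hs (g Q * dual_form (p Q) ^ e)) =
      fold dir_deriv ?hs (g P * dual_form (p P) ^ e)"
    using assms(1,7) by (subst sum.remove) auto
  then have 0: "fold dir_deriv ?hs (g P * dual_form (p P) ^ e) = 0"
    using assms(6) by (simp flip: fold_dir_deriv_sum)
  have "\<exists>g'. fold dir_deriv ?hs (g P * dual_form (p P) ^ e) = g' * dual_form (p P) ^ (e - length ?hs)
           \<and> (g' = 0 \<longrightarrow> g P = 0)"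
    using assms(3,4,7) hs len by (intro fold_dir_deriv_mult_power) auto
  with 0 show ?thesis
    using assms(5,7) by (auto simp: dual_form_eq_0_iff)
qed

text \<open>For \<open>e = d\<close> and positive \<open>n\<close> this is the part of degree
  \<open>d + n - 1\<close> of the ideal. Exponent and index are separate parameters because a
  derivative lowers only the first, the operator of the quadric both.\<close>

definition power_comb :: "'a set \<Rightarrow> ('a \<Rightarrow> 'k::field ^ 4) \<Rightarrow> nat \<Rightarrow> nat \<Rightarrow> 'k poly4 set" where
  "power_comb S p e n =
     {\<Sum>P\<in>S. g P * dual_form (p P) ^ e | g. \<forall>P\<in>S. g P \<in> homog_pred n}"

lemma power_combI:
  "f = (\<Sum>P\<in>S. g P * dual_form (p P) ^ e) \<Longrightarrow> (\<And>P. P \<in> S \<Longrightarrow> g P \<in> homog_pred n) \<Longrightarrow>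
     f \<in> power_comb S p e n"
  by (auto simp: power_comb_def)

lemma power_combE:
  assumes "f \<in> power_comb S p e n"
  obtains g where "f = (\<Sum>P\<in>S. g P * dual_form (p P) ^ e)" "\<And>P. P \<in> S \<Longrightarrow> g P \<in> homog_pred n"
  using assms by (auto simp: power_comb_def)

lemma power_comb_zero [simp]: "0 \<in> power_comb S p e n"
  by (rule power_combI[where g = "\<lambda>_. 0"]) auto

lemma power_comb_0_right [simp]: "power_comb S p e 0 = {0}"
  by (auto simp: power_comb_def intro!: exI[of _ "\<lambda>_. 0"])

lemma power_comb_add:
  assumes "f \<in> power_comb S p e n" "f' \<in> power_comb S p e n"
  shows "f + f' \<in> power_comb S p e n"
proof -
  obtain g g' where "f = (\<Sum>P\<in>S. g P * dual_form (p P) ^ e)" "\<And>P. P \<in> S \<Longrightarrow> g P \<in> homog_pred n"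
    "f' = (\<Sum>P\<in>S. g' P * dual_form (p P) ^ e)" "\<And>P. P \<in> S \<Longrightarrow> g' P \<in> homog_pred n"
    using assms by (elim power_combE) blast
  then show ?thesis
    by (intro power_combI[where g = "\<lambda>P. g P + g' P"])
      (auto simp: sum.distrib distrib_right intro: homog_pred_add)
qed

lemma power_comb_sum:
  "(\<And>x. x \<in> A \<Longrightarrow> f x \<in> power_comb S p e n) \<Longrightarrow> (\<Sum>x\<in>A. f x) \<in> power_comb S p e n"
  by (induction A rule: infinite_finite_induct) (auto intro: power_comb_add)

lemma power_comb_homog_mult:
  assumes "h \<in> homog s" "f \<in> power_comb S p e n"
  shows "h * f \<in> power_comb S p e (s + n)"
proof -
  obtain g where f: "f = (\<Sum>P\<in>S. g P * dual_form (p P) ^ e)" "\<And>P. P \<in> S \<Longrightarrow> g P \<in> homog_pred n"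
    using assms(2) by (elim power_combE) blast
  show ?thesis
    by (rule power_combI[where g = "\<lambda>P. h * g P"])
      (auto simp: f(1) sum_distrib_left mult.assoc intro: homog_mult_pred assms(1) f(2))
qed

lemma power_comb_Const_mult: "f \<in> power_comb S p e n \<Longrightarrow> Const c * f \<in> power_comb S p e n"
  using power_comb_homog_mult[OF Const_homog] by fastforce

lemma power_comb_uminus: "f \<in> power_comb S p e n \<Longrightarrow> - f \<in> power_comb S p e n"
  using power_comb_Const_mult[of f S p e n "-1"] by (simp add: Const_def single_uminus)

lemma power_comb_diff:
  "f \<in> power_comb S p e n \<Longrightarrow> f' \<in> power_comb S p e n \<Longrightarrow> f - f' \<in> power_comb S p e n"
  using power_comb_add[OF _ power_comb_uminus, of f S p e n f'] by simp

lemma power_comb_of_nat_mult_cancel: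
  fixes f :: "'k::field_char_0 poly4"
  assumes "of_nat c * f \<in> power_comb S p e n" "c > 0"
  shows "f \<in> power_comb S p e n"
  using power_comb_Const_mult[OF assms(1), of "inverse (of_nat c)"] assms(2)
  by (simp add: Const_inverse_mult_cancel flip: Const_of_nat)

lemma dir_deriv_power_comb:
  assumes "f \<in> power_comb S p (Suc e) n"
  shows "dir_deriv v f \<in> power_comb S p e n"
proof -
  obtain g where f: "f = (\<Sum>P\<in>S. g P * dual_form (p P) ^ Suc e)" "\<And>P. P \<in> S \<Longrightarrow> g P \<in> homog_pred n"
    using assms by (elim power_combE) blast
  show ?thesis
    unfolding f(1) dir_deriv_sum dir_deriv_mult_power
    by (rule power_combI[OF refl]) (intro homog_pred_twisted f(2))
qed

lemma power_comb_homog_pred: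
  assumes "f \<in> power_comb S p e n"
  shows "f \<in> homog_pred (e + n)"
proof -
  obtain g where f: "f = (\<Sum>P\<in>S. g P * dual_form (p P) ^ e)" "\<And>P. P \<in> S \<Longrightarrow> g P \<in> homog_pred n"
    using assms by (elim power_combE) blast
  show ?thesis
    unfolding f(1) by (subst mult.commute) (intro homog_pred_sum homog_mult_pred dual_form_power_homog f(2))
qed

text \<open>A closed form with coefficients in the combinations of \<open>e\<close>-th powers integrates termwise,
  because power combinations are unique.\<close>

lemma power_comb_integrate:
  fixes p :: "'a \<Rightarrow> 'k::field_char_0 ^ 4"
  assumes S: "finite S" "separates S p c" "\<forall>P\<in>S. p P \<noteq> 0"
    and u: "u \<in> homog s" "s > 0" "s = Suc e + n"
    and n: "n > 0 \<Longrightarrow> n * c \<le> e"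
    and deriv: "\<And>i. partial_deriv i u \<in> power_comb S p (Suc e) n"
  shows "u \<in> power_comb S p (Suc (Suc e)) n"
proof (cases n)
  case 0
  then have "u = 0"
    using deriv by (intro homog_partial_derivs_zero[OF u(1,2)]) simp
  then show ?thesis by simp
next
  case (Suc n')
  have "\<forall>i. \<exists>g. partial_deriv i u = (\<Sum>P\<in>S. g P * dual_form (p P) ^ Suc e) \<and> (\<forall>P\<in>S. g P \<in> homog_pred n)"
    using deriv unfolding power_comb_def by blast
  from choice[OF this] obtain g where
    g: "\<And>i. partial_deriv i u = (\<Sum>P\<in>S. g i P * dual_form (p P) ^ Suc e)"
      "\<And>i P. P \<in> S \<Longrightarrow> g i P \<in> homog_pred n"
    by blast
  \<comment> \<open>The coefficient at \<open>P\<close> when the expansion of the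
    \<open>i\<close>-th derivative is differentiated in direction \<open>j\<close>.\<close>
  define q where "q i j P = partial_deriv j (g i P) * dual_form (p P)
      + of_nat (Suc e) * Const (p P $ j) * g i P" for i j P
  have q: "partial_deriv j (partial_deriv i u) = (\<Sum>P\<in>S. q i j P * dual_form (p P) ^ e)"
    and q_homog: "P \<in> S \<Longrightarrow> q i j P \<in> homog_pred n" for i j P
    using dir_deriv_mult_power[of "axis j 1 :: 'k ^ 4"] homog_pred_twisted[OF g(2), of P "axis j 1" i]
    by (simp_all add: g(1) partial_deriv_sum dir_deriv_axis pairing_axis q_def del: of_nat_Suc power_Suc)
  \<comment> \<open>Mixed derivatives of \<open>u\<close> agree; uniqueness at exponent
    \<open>e\<close> transfers this to each \<open>P\<close> separately.\<close>
  have sym: "q i j P = q j i P" if "P \<in> S" for i j P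
  proof -
    have "q i j P - q j i P = 0"
    proof (rule power_comb_unique[OF S(1,2) _ _ S(3) _ that, of n e "\<lambda>P. q i j P - q j i P"])
      show "(\<Sum>P\<in>S. (q i j P - q j i P) * dual_form (p P) ^ e) = 0"
        using q[of j i] q[of i j] partial_deriv_commute[of i j u]
        by (simp add: left_diff_distrib sum_subtractf)
      show "\<forall>P\<in>S. q i j P - q j i P \<in> homog_pred n"
        by (intro ballI homog_pred_diff q_homog)
    qed (use n Suc in simp)
    then show ?thesis by simp
  qed
  \<comment> \<open>By Euler's identity \<open>s * u\<close> is the sum of the
    \<open>w P * dual_form (p P) ^ Suc e\<close>, so what is missing is one linear factor in
    \<open>w P\<close>.\<close>
  define w where "w P = (\<Sum>i\<in>UNIV. Var i * g i P)" for P
  \<comment> \<open>Symmetry turns the sum of \<open>Var i * q i j P\<close> into that of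
    \<open>Var i * q j i P\<close>, in which Euler's identity for \<open>g j P\<close> and the
    definition of the linear form both exhibit the factor \<open>dual_form (p P)\<close>. The
    constant is 1 + n' + Suc e = s.\<close>
  have w: "of_nat (Suc e) * Const (p P $ j) * w P =
      (of_nat s * g j P - partial_deriv j (w P)) * dual_form (p P)" if "P \<in> S" for P j
  proof -
    have "partial_deriv j (w P) = (\<Sum>i\<in>UNIV. of_bool (i = j) * g i P + Var i * partial_deriv j (g i P))"
      by (simp add: w_def partial_deriv_sum partial_deriv_mult partial_deriv_Var eq_commute[of j])
    also have "\<dots> = g j P + (\<Sum>i\<in>UNIV. Var i * partial_deriv j (g i P))"
      by (simp add: sum.distrib of_bool_def if_distrib[of "\<lambda>x. x * _"] cong: if_cong)
    finally have "partial_deriv j (w P) * dual_form (p P) + of_nat (Suc e) * Const (p P $ j) * w P =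
        g j P * dual_form (p P) + (\<Sum>i\<in>UNIV. Var i * q i j P)"
      by (simp add: q_def w_def sum_distrib_left sum_distrib_right sum.distrib algebra_simps del: of_nat_Suc)
    also have "(\<Sum>i\<in>UNIV. Var i * q i j P) = (\<Sum>i\<in>UNIV. Var i * q j i P)"
      by (intro sum.cong refl arg_cong[of _ _ "\<lambda>x. _ * x"] sym that)
    also have "\<dots> = (\<Sum>i\<in>UNIV. Var i * partial_deriv i (g j P)) * dual_form (p P)
        + of_nat (Suc e) * g j P * (\<Sum>i\<in>UNIV. Const (p P $ i) * Var i)"
      by (simp add: q_def sum_distrib_left sum_distrib_right sum.distrib algebra_simps del: of_nat_Suc)
    also have "(\<Sum>i\<in>UNIV. Var i * partial_deriv i (g j P)) = of_nat n' * g j P"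
      using g(2)[OF that, of j] Suc by (intro euler) simp
    finally show ?thesis
      unfolding dual_form_eq[symmetric] u(3) Suc by (simp add: algebra_simps)
  qed
  have "\<exists>w'. w P = w' * dual_form (p P) \<and> w' \<in> homog_pred n" if "P \<in> S" for P
  proof -
    \<comment> \<open>A nonzero coordinate of \<open>p P\<close> makes the scalar on the left of
      \<open>w\<close> invertible, so \<open>w P\<close> is divisible by the form.\<close>
    obtain j where "p P $ j \<noteq> 0"
      using S(3) \<open>P \<in> S\<close> by (auto simp: vec_eq_iff)
    then have c: "of_nat (Suc e) * p P $ j \<noteq> 0"
      by (simp del: of_nat_Suc)
    let ?w' = "Const (inverse (of_nat (Suc e) * p P $ j)) * (of_nat s * g j P - partial_deriv j (w P))"
    have "w P \<in> homog_pred (Suc n)"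
      unfolding w_def by (intro homog_pred_sum homog_pred_Var_mult g(2) that)
    from partial_deriv_homog_pred[OF this, of j] have "?w' \<in> homog_pred n"
      by (intro homog_pred_Const_mult homog_pred_diff homog_pred_of_nat_mult g(2) that) simp
    moreover have "w P = ?w' * dual_form (p P)"
      unfolding mult.assoc w[OF that, of j, symmetric]
      using Const_inverse_mult_cancel[OF c, of "w P"] by (simp only: Const_mult Const_of_nat mult.assoc)
    ultimately show ?thesis by blast
  qed
  then have "\<forall>P\<in>S. \<exists>w'. w P = w' * dual_form (p P) \<and> w' \<in> homog_pred n"
    by blast
  from bchoice[OF this] obtain w' where w': "\<And>P. P \<in> S \<Longrightarrow> w P = w' P * dual_form (p P)"
      "\<And>P. P \<in> S \<Longrightarrow> w' P \<in> homog_pred n"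
    by blast
  have "of_nat s * u = (\<Sum>i\<in>UNIV. Var i * partial_deriv i u)"
    using euler[OF u(1)] by simp
  also have "\<dots> = (\<Sum>P\<in>S. w P * dual_form (p P) ^ Suc e)"
    unfolding g(1) w_def sum_distrib_left sum_distrib_right mult.assoc by (rule sum.swap)
  also have "\<dots> = (\<Sum>P\<in>S. w' P * dual_form (p P) ^ Suc (Suc e))"
    using w'(1) by (intro sum.cong) (auto simp: mult.assoc)
  finally have "of_nat s * u \<in> power_comb S p (Suc (Suc e)) n"
    using w'(2) by (rule power_combI)
  then show ?thesis
    using u(2) by (rule power_comb_of_nat_mult_cancel)
qed

subsection \<open>The operator of the quadric\<close>

text \<open>The constant coefficient operator with symbol \<open>\<Sum>\<^sub>i\<^sub>j A\<^sub>i\<^sub>j x\<^sub>i x\<^sub>j\<close>.\<close>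

definition laplacian :: "'k::field ^ 4 ^ 4 \<Rightarrow> 'k poly4 \<Rightarrow> 'k poly4" where
  "laplacian A f = (\<Sum>i\<in>UNIV. partial_deriv i (dir_deriv (A $ i) f))"

lemma laplacian_zero [simp]: "laplacian A 0 = 0"
  by (simp add: laplacian_def)

lemma laplacian_add: "laplacian A (f + g) = laplacian A f + laplacian A g"
  by (simp add: laplacian_def dir_deriv_add partial_deriv_add sum.distrib)

lemma laplacian_sum: "laplacian A (\<Sum>x\<in>B. f x) = (\<Sum>x\<in>B. laplacian A (f x))"
  by (induction B rule: infinite_finite_induct) (auto simp: laplacian_add)

lemma dir_deriv_laplacian_commute: "dir_deriv v (laplacian A f) = laplacian A (dir_deriv v f)"
  by (simp add: laplacian_def dir_deriv_sum dir_deriv_partial_deriv_commute dir_deriv_commute[of v])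

lemma symmetric_matrix_entry:
  fixes A :: "'k ^ 'n ^ 'n"
  assumes "transpose A = A"
  shows "A $ i $ j = A $ j $ i"
  using arg_cong[OF assms, of "\<lambda>B. B $ i $ j"] by (simp add: transpose_def)

lemma laplacian_mult:
  assumes "transpose A = A"
  shows "laplacian A (f * g) =
    laplacian A f * g + 2 * (\<Sum>i\<in>UNIV. dir_deriv (A $ i) f * partial_deriv i g) + f * laplacian A g"
proof -
  note A = symmetric_matrix_entry[OF assms(1)]
  have "(\<Sum>i\<in>UNIV. partial_deriv i f * dir_deriv (A $ i) g)
      = (\<Sum>i\<in>UNIV. \<Sum>j\<in>UNIV. Const (A $ j $ i) * partial_deriv i f * partial_deriv j g)"
    unfolding dir_deriv_def sum_distrib_left by (intro sum.cong refl) (simp add: A mult_ac)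
  also have "\<dots> = (\<Sum>i\<in>UNIV. dir_deriv (A $ i) f * partial_deriv i g)"
    unfolding dir_deriv_def sum_distrib_right by (rule sum.swap)
  finally have "(\<Sum>i\<in>UNIV. partial_deriv i f * dir_deriv (A $ i) g)
      = (\<Sum>i\<in>UNIV. dir_deriv (A $ i) f * partial_deriv i g)" .
  then show ?thesis
    by (simp add: laplacian_def dir_deriv_mult partial_deriv_add partial_deriv_mult sum.distrib
        sum_distrib_left sum_distrib_right algebra_simps flip: mult_2)
qed

lemma laplacian_Var: "laplacian A (Var k) = 0"
  by (simp add: laplacian_def dir_deriv_Var)

lemma laplacian_Var_mult:
  assumes "transpose A = A"
  shows "laplacian A (Var k * f) = Var k * laplacian A f + 2 * dir_deriv (A $ k) f"
proof -
  note A = symmetric_matrix_entry[OF assms(1)]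
  show ?thesis
    using A[of _ k] by (simp add: laplacian_mult[OF assms] laplacian_Var dir_deriv_Var dir_deriv_def[of _ f])
qed

text \<open>The commutator of the operator with a variable is twice a directional derivative, which
  commutes with the operator; passing to powers just adds up copies of it.\<close>

lemma laplacian_power_Var_mult:
  assumes "transpose A = A"
  shows "(laplacian A ^^ Suc n) (Var k * f) = Var k * (laplacian A ^^ Suc n) f
    + of_nat (2 * Suc n) * dir_deriv (A $ k) ((laplacian A ^^ n) f)"
proof (induction n)
  case 0
  show ?case by (simp add: laplacian_Var_mult[OF assms])
next
  case (Suc n)
  have of_nat: "laplacian A (of_nat m * g) = of_nat m * laplacian A g" for m g
    by (induction m) (simp_all add: laplacian_add distrib_right)
  have "(laplacian A ^^ Suc (Suc n)) (Var k * f) = laplacian A (Var k * (laplacian A ^^ Suc n) f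
    + of_nat (2 * Suc n) * dir_deriv (A $ k) ((laplacian A ^^ n) f))"
    using Suc by simp
  also have "\<dots> = Var k * (laplacian A ^^ Suc (Suc n)) f
    + of_nat (2 * Suc (Suc n)) * dir_deriv (A $ k) ((laplacian A ^^ Suc n) f)"
    unfolding laplacian_add of_nat laplacian_Var_mult[OF assms] dir_deriv_laplacian_commute[symmetric]
    by (simp add: algebra_simps)
  finally show ?case .
qed

lemma laplacian_homog_pred: "f \<in> homog_pred n \<Longrightarrow> laplacian A f \<in> homog_pred (n - 2)"
  unfolding laplacian_def using partial_deriv_homog_pred[OF dir_deriv_homog_pred, of f n]
  by (intro homog_pred_sum) (simp add: numeral_2_eq_2)

lemma laplacian_funpow_homog_pred: "f \<in> homog_pred n \<Longrightarrow> (laplacian A ^^ k) f \<in> homog_pred (n - 2 * k)"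
  by (induction k) (auto dest: laplacian_homog_pred)

text \<open>The operator annihilates every power of \<open>dual_form w\<close> because
  \<open>w\<close> is isotropic; only the terms with a derivative on \<open>g\<close> remain, and
  each keeps at least \<open>e\<close> factors.\<close>

lemma laplacian_mult_power:
  assumes "transpose A = A" and isotropic: "pairing w (A *v w) = 0"
  shows "laplacian A (g * dual_form w ^ Suc e) =
    (laplacian A g * dual_form w + of_nat (2 * Suc e) * dir_deriv (A *v w) g) * dual_form w ^ e"
proof -
  note A = symmetric_matrix_entry[OF assms(1)]
  have Aw: "pairing (A $ i) w = (A *v w) $ i" for i
    by (simp add: pairing_def matrix_vector_mult_def)
  have "partial_deriv i (dual_form w) = Const (w $ i)" for i
    using dir_deriv_dual_form[of "axis i 1" w] by (simp add: dir_deriv_axis pairing_axis)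
  then have pd: "partial_deriv i (dual_form w ^ Suc n) = of_nat (Suc n) * Const (w $ i) * dual_form w ^ n" for i n
    using dir_deriv_power_Suc[of "axis i 1" "dual_form w" n] by (simp add: dir_deriv_axis)
  have dd: "dir_deriv (A $ i) (dual_form w ^ Suc n) = of_nat (Suc n) * Const ((A *v w) $ i) * dual_form w ^ n" for i n
    by (simp only: dir_deriv_power_Suc dir_deriv_dual_form Aw)
  have zero: "(\<Sum>i\<in>UNIV. Const ((A *v w) $ i) * Const (w $ i)) = 0"
    using isotropic by (simp add: pairing_def mult.commute flip: Const_mult Const_sum)
  have "laplacian A (dual_form w ^ Suc e) = 0"
  proof (cases e)
    case 0
    then show ?thesis by (simp add: laplacian_def dir_deriv_dual_form)
  next
    case (Suc n)
    \<comment> \<open>Two derivatives of the power bring out the value of the quadric at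
      \<open>w\<close>.\<close>
    have "laplacian A (dual_form w ^ Suc e) =
      of_nat (Suc e) * of_nat (Suc n) * (\<Sum>i\<in>UNIV. Const ((A *v w) $ i) * Const (w $ i)) * dual_form w ^ n"
      unfolding laplacian_def dd Suc partial_deriv_mult pd
      by (simp add: sum_distrib_left sum_distrib_right mult_ac flip: Const_of_nat del: of_nat_Suc)
    then show ?thesis using zero by simp
  qed
  moreover have "(\<Sum>i\<in>UNIV. dir_deriv (A $ i) g * partial_deriv i (dual_form w ^ Suc e))
      = of_nat (Suc e) * dir_deriv (A *v w) g * dual_form w ^ e"
  proof -
    have "(\<Sum>i\<in>UNIV. Const (w $ i) * dir_deriv (A $ i) g) = dir_deriv (A *v w) g"
      unfolding dir_deriv_def matrix_vector_mult_def sum_distrib_left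
      by (subst sum.swap) (simp add: Const_sum Const_mult sum_distrib_left sum_distrib_right A mult_ac)
    then show ?thesis
      unfolding pd by (simp add: sum_distrib_left sum_distrib_right mult_ac del: of_nat_Suc
        flip: \<open>(\<Sum>i\<in>UNIV. Const (w $ i) * dir_deriv (A $ i) g) = dir_deriv (A *v w) g\<close>)
  qed
  ultimately show ?thesis
    unfolding laplacian_mult[OF assms(1)] by (simp add: algebra_simps)
qed

text \<open>In the new coefficient the operator takes two degrees from \<open>g P\<close> and the
  linear form returns one, while the directional derivative takes one.\<close>

lemma laplacian_power_comb:
  assumes A: "transpose A = A" "\<forall>P\<in>S. pairing (p P) (A *v p P) = 0"
    and f: "f \<in> power_comb S p (Suc e) n"
  shows "laplacian A f \<in> power_comb S p e (n - 1)"
proof -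
  obtain g where f: "f = (\<Sum>P\<in>S. g P * dual_form (p P) ^ Suc e)" "\<And>P. P \<in> S \<Longrightarrow> g P \<in> homog_pred n"
    using f by (elim power_combE) blast
  let ?g = "\<lambda>P. laplacian A (g P) * dual_form (p P) + of_nat (2 * Suc e) * dir_deriv (A *v p P) (g P)"
  have "laplacian A f = (\<Sum>P\<in>S. ?g P * dual_form (p P) ^ e)"
    unfolding f(1) laplacian_sum by (intro sum.cong refl laplacian_mult_power A(1)) (use A(2) in blast)
  moreover have "?g P \<in> homog_pred (n - 1)" if "P \<in> S" for P
  proof -
    have "laplacian A (g P) * dual_form (p P) \<in> homog_pred (n - 1)"
    proof (cases "n \<le> 1")
      case True
      then show ?thesis using laplacian_homog_pred[OF f(2)[OF that], of A] by simp
    next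
      case False
      then show ?thesis
        using homog_mult_pred[OF dual_form_homog laplacian_homog_pred[OF f(2)[OF that], of A], of "p P"]
        by (simp add: mult.commute numeral_2_eq_2 Suc_diff_Suc)
    qed
    then show ?thesis
      by (intro homog_pred_add homog_pred_of_nat_mult dir_deriv_homog_pred f(2) that)
  qed
  ultimately show ?thesis by (rule power_combI)
qed

lemma laplacian_funpow_power_comb:
  assumes A: "transpose A = A" "\<forall>P\<in>S. pairing (p P) (A *v p P) = 0"
    and f: "f \<in> power_comb S p (k + e) n"
  shows "(laplacian A ^^ k) f \<in> power_comb S p e (n - k)"
  using f
proof (induction k arbitrary: e)
  case (Suc k)
  then show ?case
    using laplacian_power_comb[OF A, of "(laplacian A ^^ k) f" e "n - k"] by simp
qed simp

text \<open>Descending induction on \<open>k\<close> for \<open>\<Delta>\<^sup>k f\<close>: the commutator of \<open>\<Delta>\<^sup>k\<^sup>+\<^sup>1\<close> with multiplication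
  by a variable yields the derivatives of \<open>\<Delta>\<^sup>k f\<close>, which are then integrated.\<close>

lemma power_comb_of_Var_mult:
  fixes p :: "'a \<Rightarrow> 'k::field_char_0 ^ 4"
  assumes S: "finite S" "separates S p c" "\<forall>P\<in>S. p P \<noteq> 0"
    and A: "transpose A = A" "\<forall>P\<in>S. pairing (p P) (A *v p P) = 0" "invertible A"
    and f: "f \<in> homog t" "t + 2 = d + m" "\<And>i. Var i * f \<in> power_comb S p d m"
    and d: "m < d" "\<And>k. k + 2 \<le> m \<Longrightarrow> (m - 1 - k) * c + k + 2 \<le> d"
  shows "f \<in> power_comb S p d (m - 1)"
proof (cases "m = 0")
  case True
  then have "Var 1 * f = 0" using f(3)[of 1] by simp
  then show ?thesis by simp
next
  case False
  let ?L = "laplacian A"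
  obtain d' where d': "d = Suc d'" using d(1) by (cases d) auto
  \<comment> \<open>Summing the derivatives of \<open>Var i * f\<close> gives
    \<open>(4 + t) * f\<close>, four being the number of variables; so \<open>f\<close> is a
    combination with exponent \<open>d - 1\<close>, from which the descent starts.\<close>
  have "(\<Sum>i\<in>UNIV. partial_deriv i (Var i * f)) = of_nat (4 + t) * f"
    using euler[OF f(1)] by (simp add: partial_deriv_mult partial_deriv_Var sum.distrib distrib_right)
  moreover have "(\<Sum>i\<in>UNIV. partial_deriv i (Var i * f)) \<in> power_comb S p d' m"
    using dir_deriv_power_comb[of _ S p d' m] f(3) d'
    by (intro power_comb_sum) (metis dir_deriv_axis)
  ultimately have f': "f \<in> power_comb S p d' m"
    by (metis add_gr_0 power_comb_of_nat_mult_cancel zero_less_numeral)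
  have "(?L ^^ k) f \<in> power_comb S p (d - k) (m - 1 - k)" if "k \<le> m" for k
    using that
  proof (induction k rule: inc_induct)
    case base
    \<comment> \<open>Each application of the operator uses up one index of the coefficients, so
      \<open>m\<close> of them kill \<open>f\<close>; \<open>m < d\<close> provides the
      exponents.\<close>
    have "(?L ^^ m) f \<in> power_comb S p (d' - m) 0"
      using laplacian_funpow_power_comb[OF A(1,2), of f m "d' - m" m] f' d(1) d' by simp
    then show ?case by simp
  next
    case (step k)
    let ?u = "(?L ^^ k) f" and ?n = "m - 1 - k"
    have "2 \<le> d - k"
      using step.hyps d(1) by linarith
    then obtain e where e: "d - k = Suc (Suc e)"
      by (metis add_2_eq_Suc le_Suc_ex)
    then have d_eq: "d = Suc k + Suc e"
      by linarith
    have 1: "(?L ^^ Suc k) (Var i * f) \<in> power_comb S p (Suc e) ?n" for i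
      using laplacian_funpow_power_comb[OF A(1,2), of "Var i * f" "Suc k" "Suc e" m] f(3)[of i]
      unfolding d_eq by (simp only: diff_diff_left plus_1_eq_Suc)
    have 2: "Var i * (?L ^^ Suc k) f \<in> power_comb S p (Suc e) ?n" for i
    proof (cases "?n = 0")
      case True
      then show ?thesis using step.IH by simp
    next
      case False
      have "d - Suc k = Suc e" using e by simp
      then show ?thesis
        using power_comb_homog_mult[OF Var_homog[of i] step.IH] False by (simp add: Suc_diff_Suc)
    qed
    \<comment> \<open>The commutator formula: the two other terms lie in the same space.\<close>
    have "of_nat (2 * Suc k) * dir_deriv (A $ i) ?u \<in> power_comb S p (Suc e) ?n" for i
      using power_comb_diff[OF 1[of i] 2[of i]] laplacian_power_Var_mult[OF A(1), of k i f] by simp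
    then have D: "dir_deriv (A $ i) ?u \<in> power_comb S p (Suc e) ?n" for i
      by (rule power_comb_of_nat_mult_cancel) simp
    \<comment> \<open>The derivatives obtained are those along the rows of \<open>A\<close>;
      inverting \<open>A\<close> turns them into the partial derivatives.\<close>
    obtain B where B: "B ** A = mat 1"
      using A(3) by (auto simp: invertible_def)
    have "partial_deriv j ?u = (\<Sum>i\<in>UNIV. Const (B $ j $ i) * dir_deriv (A $ i) ?u)" for j
    proof -
      have "(\<Sum>i\<in>UNIV. Const (B $ j $ i) * dir_deriv (A $ i) ?u) =
          (\<Sum>l\<in>UNIV. Const ((B ** A) $ j $ l) * partial_deriv l ?u)"
        unfolding dir_deriv_def matrix_matrix_mult_def sum_distrib_left
        by (subst sum.swap) (simp add: Const_sum Const_mult sum_distrib_left sum_distrib_right mult_ac)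
      also have "\<dots> = partial_deriv j ?u"
        by (simp add: B mat_def if_distrib[of Const] if_distrib[of "\<lambda>x. x * _"] cong: if_cong)
      finally show ?thesis by simp
    qed
    then have deriv: "partial_deriv j ?u \<in> power_comb S p (Suc e) ?n" for j
      by (simp only:) (intro power_comb_sum power_comb_Const_mult D)
    have "?u \<in> power_comb S p (Suc (Suc e)) ?n"
    proof (rule power_comb_integrate[OF S _ _ _ _ deriv])
      show "?u \<in> homog (Suc e + ?n)"
      proof -
        have "Suc t - 2 * k = Suc (Suc e + ?n)"
          using f(2) e step.hyps by linarith
        then show ?thesis
          using laplacian_funpow_homog_pred[of f "Suc t" k A] f(1) by simp
      qed
    next
      assume "?n > 0"
      then have "(m - 1 - k) * c + k + 2 \<le> d" by (intro d(2)) simp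
      then show "?n * c \<le> e" using e by simp
    qed auto
    then show ?case using e by simp
  qed
  from this[of 0] show ?thesis by simp
qed

subsection \<open>The ideal and its components\<close>

lemma ideal_gen_powers_eq:
  fixes p :: "'a \<Rightarrow> 'k::field ^ 4"
  assumes "finite S"
  shows "ideal_gen {dual_form (p P) ^ d | P. P \<in> S} = range (\<lambda>g. \<Sum>P\<in>S. g P * dual_form (p P) ^ d)"
proof -
  interpret R: Modules.module "(*) :: 'k poly4 \<Rightarrow> 'k poly4 \<Rightarrow> 'k poly4"
    by unfold_locales (simp_all add: algebra_simps)
  let ?c = "\<lambda>g. \<Sum>P\<in>S. g P * dual_form (p P) ^ d"
  have "R.span {dual_form (p P) ^ d | P. P \<in> S} = range ?c"
  proof (rule R.span_subspace)
    show "{dual_form (p P) ^ d | P. P \<in> S} \<subseteq> range ?c"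
    proof safe
      fix P assume "P \<in> S"
      then have "dual_form (p P) ^ d = ?c (\<lambda>Q. of_bool (Q = P))"
        using assms by (simp add: of_bool_def if_distrib[of "\<lambda>x. x * _"] cong: if_cong)
      then show "dual_form (p P) ^ d \<in> range ?c"
        by (rule range_eqI[of _ ?c "\<lambda>Q. of_bool (Q = P)"])
    qed
    show "R.subspace (range ?c)"
    proof (rule R.subspaceI)
      show "0 \<in> range ?c" by (rule range_eqI[of _ _ "\<lambda>_. 0"]) simp
      show "x + y \<in> range ?c" if xy: "x \<in> range ?c" "y \<in> range ?c" for x y
      proof -
        obtain g where "x = ?c g" using xy(1) by (rule rangeE)
        moreover obtain g' where "y = ?c g'" using xy(2) by (rule rangeE)
        ultimately have "x + y = ?c (\<lambda>P. g P + g' P)" by (simp add: sum.distrib distrib_right)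
        then show ?thesis by (rule range_eqI[of _ ?c "\<lambda>P. g P + g' P"])
      qed
      show "c * x \<in> range ?c" if x: "x \<in> range ?c" for c x
      proof -
        obtain g where "x = ?c g" using x by (rule rangeE)
        then have "c * x = ?c (\<lambda>P. c * g P)" by (simp only: sum_distrib_left mult.assoc)
        then show ?thesis by (rule range_eqI[of _ ?c "\<lambda>P. c * g P"])
      qed
    qed
    show "range ?c \<subseteq> R.span {dual_form (p P) ^ d | P. P \<in> S}"
    proof
      fix f assume "f \<in> range ?c"
      then obtain g where f: "f = ?c g" by (rule rangeE)
      show "f \<in> R.span {dual_form (p P) ^ d | P. P \<in> S}"
        unfolding f by (intro R.span_sum R.span_scale R.span_base) blast
    qed
  qed
  then show ?thesis by (simp add: ideal_gen_def)
qed

lemma Lambda_eq: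
  "finite G \<Longrightarrow> Lambda \<rho> G d = range (\<lambda>g. \<Sum>P\<in>G. g P * dual_form (\<rho> P) ^ d)"
  unfolding Lambda_def by (rule ideal_gen_powers_eq)

lemma homog_pred_decompose:
  obtains g0 g1 where "g = g0 + g1" "g0 \<in> homog_pred n" "\<forall>m\<in>Poly_Mapping.keys g1. Suc (mono_degree m) \<noteq> n"
proof -
  have "\<exists>g0 g1. g = g0 + g1 \<and> g0 \<in> homog_pred n \<and> (\<forall>m\<in>Poly_Mapping.keys g1. Suc (mono_degree m) \<noteq> n)"
  proof (induction g rule: poly_mapping_monomial_induct)
    case zero
    then show ?case by (intro exI[of _ 0]) simp
  next
    case (single m c)
    show ?case
    proof (cases "Suc (mono_degree m) = n")
      case True
      then show ?thesis
        by (intro exI[of _ "Poly_Mapping.single m c"] exI[of _ 0]) (simp add: homog_pred_def)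
    next
      case False
      then show ?thesis
        by (intro exI[of _ "Poly_Mapping.single m c"] exI[of _ 0]) simp
    qed
  next
    case (add f g)
    then obtain f0 f1 g0 g1 where *: "f = f0 + f1" "f0 \<in> homog_pred n"
      "\<forall>m\<in>Poly_Mapping.keys f1. Suc (mono_degree m) \<noteq> n" "g = g0 + g1" "g0 \<in> homog_pred n"
      "\<forall>m\<in>Poly_Mapping.keys g1. Suc (mono_degree m) \<noteq> n"
      by blast
    then have "f + g = (f0 + g0) + (f1 + g1)" by simp
    moreover have "\<forall>m\<in>Poly_Mapping.keys (f1 + g1). Suc (mono_degree m) \<noteq> n"
      using *(3,6) keys_add[of f1 g1] by blast
    ultimately show ?case
      using homog_pred_add[OF *(2,5)] by blast
  qed
  then show ?thesis using that by blast
qed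

text \<open>Dropping from each coefficient the monomials of the wrong degree leaves the
  degree-\<open>s\<close> part of the sum unchanged. For \<open>s < d\<close> the truncated
  difference is 0, and both sides are zero.\<close>

lemma component_Lambda_eq:
  assumes "finite G"
  shows "component (Lambda \<rho> G d) s = power_comb G \<rho> d (Suc s - d)"
proof
  show "component (Lambda \<rho> G d) s \<subseteq> power_comb G \<rho> d (Suc s - d)"
  proof
    fix f assume "f \<in> component (Lambda \<rho> G d) s"
    then obtain g where f: "f \<in> homog s" "f = (\<Sum>P\<in>G. g P * dual_form (\<rho> P) ^ d)"
      by (auto simp: component_def Lambda_eq[OF assms])
    let ?n = "Suc s - d"
    have "\<forall>P. \<exists>g0. g0 \<in> homog_pred ?n \<and> (\<forall>m\<in>Poly_Mapping.keys (g P - g0). Suc (mono_degree m) \<noteq> ?n)"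
    proof
      fix P
      obtain g0 g1 where "g P = g0 + g1" "g0 \<in> homog_pred ?n" "\<forall>m\<in>Poly_Mapping.keys g1. Suc (mono_degree m) \<noteq> ?n"
        by (rule homog_pred_decompose)
      then show "\<exists>g0. g0 \<in> homog_pred ?n \<and> (\<forall>m\<in>Poly_Mapping.keys (g P - g0). Suc (mono_degree m) \<noteq> ?n)"
        by (intro exI[of _ g0]) simp
    qed
    from choice[OF this] obtain g0 where g0: "\<And>P. g0 P \<in> homog_pred ?n"
      "\<And>P m. m \<in> Poly_Mapping.keys (g P - g0 P) \<Longrightarrow> Suc (mono_degree m) \<noteq> ?n"
      by blast
    define f0 where "f0 = (\<Sum>P\<in>G. g0 P * dual_form (\<rho> P) ^ d)"
    have f0: "f0 \<in> power_comb G \<rho> d ?n"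
      using f0_def g0(1) by (rule power_combI)
    have "mono_degree m \<noteq> s" if "m \<in> Poly_Mapping.keys (f - f0)" for m
    proof -
      have "f - f0 = (\<Sum>P\<in>G. (g P - g0 P) * dual_form (\<rho> P) ^ d)"
        by (simp add: f(2) f0_def left_diff_distrib sum_subtractf)
      with that obtain P where "m \<in> Poly_Mapping.keys ((g P - g0 P) * dual_form (\<rho> P) ^ d)"
        using keys_sum[of "\<lambda>P. (g P - g0 P) * dual_form (\<rho> P) ^ d" G] by auto
      then obtain k l where m: "m = k + l" "k \<in> Poly_Mapping.keys (g P - g0 P)"
          "l \<in> Poly_Mapping.keys (dual_form (\<rho> P) ^ d)"
        using keys_mult by blast
      then have "mono_degree l = d"
        using dual_form_power_homog[of "\<rho> P" d] by (auto simp: homog_def)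
      then show ?thesis
        using g0(2)[OF m(2)] by (simp add: m(1) mono_degree_add)
    qed
    moreover have "f - f0 \<in> homog s"
    proof (cases "d \<le> Suc s")
      case True
      then show ?thesis
        using homog_pred_diff[of f "Suc s" f0] f(1) power_comb_homog_pred[OF f0] by simp
    next
      case False
      then show ?thesis using f0 f(1) by simp
    qed
    ultimately have "Poly_Mapping.keys (f - f0) = {}"
      by (auto simp: homog_def)
    with f0 show "f \<in> power_comb G \<rho> d ?n" by simp
  qed
  show "power_comb G \<rho> d (Suc s - d) \<subseteq> component (Lambda \<rho> G d) s"
  proof
    fix f assume f: "f \<in> power_comb G \<rho> d (Suc s - d)"
    have "f \<in> homog s"
      using power_comb_homog_pred[OF f] f by (cases "d \<le> Suc s") auto
    with f show "f \<in> component (Lambda \<rho> G d) s"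
      by (auto simp: component_def Lambda_eq[OF assms] power_comb_def)
  qed
qed

lemma power_comb_subset_Lambda: "finite G \<Longrightarrow> power_comb G \<rho> d n \<subseteq> Lambda \<rho> G d"
  by (auto simp: Lambda_eq power_comb_def)

lemma Lambda_closed:
  assumes "finite G"
  shows "0 \<in> Lambda \<rho> G d"
    and "f \<in> Lambda \<rho> G d \<Longrightarrow> g \<in> Lambda \<rho> G d \<Longrightarrow> f + g \<in> Lambda \<rho> G d"
    and "f \<in> Lambda \<rho> G d \<Longrightarrow> h * f \<in> Lambda \<rho> G d"
proof -
  interpret R: Modules.module "(*) :: 'a poly4 \<Rightarrow> 'a poly4 \<Rightarrow> 'a poly4"
    by unfold_locales (simp_all add: algebra_simps)
  show "0 \<in> Lambda \<rho> G d"
    and "f \<in> Lambda \<rho> G d \<Longrightarrow> g \<in> Lambda \<rho> G d \<Longrightarrow> f + g \<in> Lambda \<rho> G d"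
    and "f \<in> Lambda \<rho> G d \<Longrightarrow> h * f \<in> Lambda \<rho> G d"
    unfolding Lambda_def ideal_gen_def
    by (rule R.span_zero R.span_add R.span_scale; assumption)+
qed

lemma subspace_power_comb: "poly4.subspace (power_comb S p e n)"
  by (intro poly4.subspaceI) (auto simp: scale_def intro: power_comb_add power_comb_Const_mult)

lemma component_eq_subspace_prod:
  assumes "finite G" "d \<le> t"
  shows "component (Lambda \<rho> G d) t = subspace_prod (homog (t - d)) (component (Lambda \<rho> G d) d)"
  unfolding component_Lambda_eq[OF assms(1)] subspace_prod_def
proof (rule sym, rule poly4.span_subspace)
  have t: "Suc t - d = Suc (t - d)" using assms(2) by simp
  show "{f * g |f g. f \<in> homog (t - d) \<and> g \<in> power_comb G \<rho> d (Suc d - d)} \<subseteq> power_comb G \<rho> d (Suc t - d)"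
    using power_comb_homog_mult[of _ "t - d" _ G \<rho> d 1] by (auto simp: t)
  show "poly4.subspace (power_comb G \<rho> d (Suc t - d))"
    by (rule subspace_power_comb)
  show "power_comb G \<rho> d (Suc t - d) \<subseteq>
      poly4.span {f * g |f g. f \<in> homog (t - d) \<and> g \<in> power_comb G \<rho> d (Suc d - d)}"
  proof
    fix f assume "f \<in> power_comb G \<rho> d (Suc t - d)"
    then obtain g where g: "f = (\<Sum>P\<in>G. g P * dual_form (\<rho> P) ^ d)" "\<And>P. P \<in> G \<Longrightarrow> g P \<in> homog (t - d)"
      by (elim power_combE) (auto simp: t)
    have "dual_form (\<rho> P) ^ d \<in> power_comb G \<rho> d (Suc d - d)" if "P \<in> G" for P
      using that assms(1) by (intro power_combI[where g = "\<lambda>Q. of_bool (Q = P)"])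
        (auto simp: of_bool_def if_distrib[of "\<lambda>x. x * _"] cong: if_cong)
    with g(2) show "f \<in> poly4.span {f * g |f g. f \<in> homog (t - d) \<and> g \<in> power_comb G \<rho> d (Suc d - d)}"
      unfolding g(1) by (intro poly4.span_sum poly4.span_base) blast
  qed
qed

section \<open>Dimension of the components\<close>

lemma card_mono_degree: "finite {m. mono_degree m = n} \<and> card {m. mono_degree m = n} = (n + 3) choose 3"
proof -
  let ?L = "{l :: nat list. size l = 4 \<and> sum_list l = n}"
  let ?f = "\<lambda>m :: 4 \<Rightarrow>\<^sub>0 nat. map (Poly_Mapping.lookup m) [1, 2, 3, 4]"
  \<comment> \<open>Exponent vectors become lists of four numbers with sum \<open>n\<close>, which
    stars and bars counts.\<close>
  have bij: "bij_betw ?f {m. mono_degree m = n} ?L"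
    unfolding bij_betw_def
  proof
    show "inj_on ?f {m. mono_degree m = n}"
    proof (intro inj_onI poly_mapping_eqI)
      fix m m' and k :: 4 assume "?f m = ?f m'"
      then show "Poly_Mapping.lookup m k = Poly_Mapping.lookup m' k"
        using exhaust_4[of k] by auto
    qed
    show "?f ` {m. mono_degree m = n} = ?L"
    proof (intro equalityI subsetI)
      fix l assume l: "l \<in> ?L"
      then obtain a b c e where [simp]: "l = [a, b, c, e]"
        by (auto simp: numeral_eq_Suc length_Suc_conv)
      let ?m = "Poly_Mapping.single (1::4) a + Poly_Mapping.single 2 b + Poly_Mapping.single 3 c + Poly_Mapping.single 4 e"
      have "?f ?m = l" by (simp add: lookup_add lookup_single)
      moreover have "mono_degree ?m = n"
        using l by (simp add: mono_degree_add)
      ultimately show "l \<in> ?f ` {m. mono_degree m = n}" by (intro image_eqI[of _ _ ?m]) simp_all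
    qed (auto simp: mono_degree_def sum_4)
  qed
  have "card ?L = (n + 4 - 1) choose n"
    by (rule card_length_sum_list)
  also have "\<dots> = (n + 3) choose 3"
    using binomial_symmetric[of 3 "n + 3"] by (simp add: add.commute)
  finally have card: "card ?L = (n + 3) choose 3" .
  then have "finite ?L" by (intro card_ge_0_finite) simp
  with card show ?thesis
    using bij_betw_finite[OF bij] bij_betw_same_card[OF bij] by simp
qed

text \<open>Uniqueness of coefficients makes the products of a monomial of degree \<open>n\<close>
  with a power into a basis, indexed by pairs of a point and a monomial.\<close>

lemma dim_power_comb:
  fixes p :: "'a \<Rightarrow> 'k::field ^ 4"
  assumes S: "finite S"
    and unique: "\<And>g. \<forall>P\<in>S. g P \<in> homog n \<Longrightarrow> (\<Sum>P\<in>S. g P * dual_form (p P) ^ e) = 0 \<Longrightarrow> \<forall>P\<in>S. g P = 0"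
  shows "poly4.dim (power_comb S p e (Suc n)) = card S * ((n + 3) choose 3)"
proof -
  let ?M = "{m :: 4 \<Rightarrow>\<^sub>0 nat. mono_degree m = n}"
  let ?b = "\<lambda>(P, m). Poly_Mapping.single m 1 * dual_form (p P) ^ e :: 'k poly4"
  have M: "finite ?M" using card_mono_degree by blast
  have zero: "c x = 0" if c: "(\<Sum>x\<in>S \<times> ?M. scale (c x) (?b x)) = 0" and x: "x \<in> S \<times> ?M" for c x
  proof -
    define g where "g P = (\<Sum>m\<in>?M. Poly_Mapping.single m (c (P, m)))" for P
    have "(\<Sum>x\<in>S \<times> ?M. scale (c x) (?b x)) = (\<Sum>P\<in>S. g P * dual_form (p P) ^ e)"
      unfolding g_def sum_distrib_right sum.cartesian_product
      by (intro sum.cong) (auto simp: scale_def Const_def mult_single simp flip: mult.assoc)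
    with c have "(\<Sum>P\<in>S. g P * dual_form (p P) ^ e) = 0" by simp
    moreover have "\<forall>P\<in>S. g P \<in> homog n"
      unfolding g_def by (intro ballI homog_sum) (simp add: homog_def)
    ultimately have g: "g P = 0" if "P \<in> S" for P
      using unique that by blast
    obtain P m where [simp]: "x = (P, m)" by fastforce
    have "Poly_Mapping.lookup (g P) m = (\<Sum>k\<in>?M. if k = m then c (P, k) else 0)"
      unfolding g_def lookup_sum by (intro sum.cong) (auto simp: lookup_single)
    also have "\<dots> = c x" using x M by simp
    finally show ?thesis using g x by simp
  qed
  have inj: "inj_on ?b (S \<times> ?M)"
  proof (intro inj_onI, rule ccontr)
    fix x y assume xy: "x \<in> S \<times> ?M" "y \<in> S \<times> ?M" "?b x = ?b y" "x \<noteq> y"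
    let ?c = "\<lambda>z. if z = x then 1 else if z = y then - 1 else (0 :: 'k)"
    have "(\<Sum>z\<in>S \<times> ?M. scale (?c z) (?b z)) = (\<Sum>z\<in>{x, y}. scale (?c z) (?b z))"
      using S M xy by (intro sum.mono_neutral_right) auto
    also have "\<dots> = 0"
      using xy(3,4) by (simp add: poly4.scale_minus_left)
    finally show False using zero[of ?c x] xy(1) by simp
  qed
  have indep: "poly4.independent (?b ` (S \<times> ?M))"
  proof (rule poly4.independent_if_scalars_zero)
    fix f x assume "(\<Sum>v\<in>?b ` (S \<times> ?M). scale (f v) v) = 0" "x \<in> ?b ` (S \<times> ?M)"
    then show "f x = 0"
      using zero[of "\<lambda>z. f (?b z)"] by (auto simp only: sum.reindex[OF inj] o_def)
  qed (use S M in simp)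
  have "poly4.span (?b ` (S \<times> ?M)) = poly4.span (power_comb S p e (Suc n))"
    unfolding poly4.span_eq
  proof
    show "?b ` (S \<times> ?M) \<subseteq> poly4.span (power_comb S p e (Suc n))"
    proof
      fix f assume "f \<in> ?b ` (S \<times> ?M)"
      then obtain P m where f: "P \<in> S" "mono_degree m = n" "f = Poly_Mapping.single m 1 * dual_form (p P) ^ e"
        by auto
      then have "f \<in> power_comb S p e (Suc n)"
        using S by (intro power_combI[where g = "\<lambda>Q. if Q = P then Poly_Mapping.single m 1 else 0"])
          (auto simp: homog_def if_distrib[of "\<lambda>x. x * _"] cong: if_cong)
      then show "f \<in> poly4.span (power_comb S p e (Suc n))" by (rule poly4.span_base)
    qed
    show "power_comb S p e (Suc n) \<subseteq> poly4.span (?b ` (S \<times> ?M))"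
    proof
      fix f assume "f \<in> power_comb S p e (Suc n)"
      then obtain g where g: "f = (\<Sum>P\<in>S. g P * dual_form (p P) ^ e)" "\<And>P. P \<in> S \<Longrightarrow> g P \<in> homog n"
        by (elim power_combE) auto
      have "g P * dual_form (p P) ^ e \<in> poly4.span (?b ` (S \<times> ?M))" if "P \<in> S" for P
      proof -
        have "g P * dual_form (p P) ^ e =
            (\<Sum>m\<in>Poly_Mapping.keys (g P). scale (Poly_Mapping.lookup (g P) m) (?b (P, m)))"
          using arg_cong[OF poly_mapping_sum_singles[of "g P"], of "\<lambda>f. f * dual_form (p P) ^ e"]
          by (simp add: sum_distrib_right scale_def Const_def mult_single flip: mult.assoc)
        also have "\<dots> \<in> poly4.span (?b ` (S \<times> ?M))"
          using g(2)[OF that] that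
          by (intro poly4.span_sum poly4.span_scale poly4.span_base imageI) (auto simp: homog_def)
        finally show ?thesis .
      qed
      then show "f \<in> poly4.span (?b ` (S \<times> ?M))"
        unfolding g(1) by (rule poly4.span_sum)
    qed
  qed
  then have "poly4.dim (power_comb S p e (Suc n)) = card (?b ` (S \<times> ?M))"
    using indep by (rule poly4.dim_eq_card)
  also have "\<dots> = card S * ((n + 3) choose 3)"
    using card_mono_degree[of n] by (simp add: card_image[OF inj] card_cartesian_product)
  finally show ?thesis .
qed

subsection \<open>Four independent points\<close>

lemma pairing_add_right: "pairing v (x + y) = pairing v x + pairing v y"
  by (simp add: pairing_def distrib_left sum.distrib)

lemma pairing_scale_right: "pairing v (c *s x) = c * pairing v x"
  by (simp add: pairing_def sum_distrib_left mult_ac)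

lemma pairing_zero_right [simp]: "pairing v 0 = 0"
  by (simp add: pairing_def)

lemma pairing_sum_right: "pairing v (\<Sum>x\<in>A. f x) = (\<Sum>x\<in>A. pairing v (f x))"
  by (induction A rule: infinite_finite_induct) (auto simp: pairing_add_right)

text \<open>The basis dual to \<open>p\<close>: when \<open>S\<close> has four elements, the forms
  \<open>dual_form (p P)\<close> serve as coordinates and the derivatives along \<open>h P\<close>
  as the partial derivatives.\<close>

definition dual_system :: "'a set \<Rightarrow> ('a \<Rightarrow> 'k::field ^ 4) \<Rightarrow> ('a \<Rightarrow> 'k ^ 4) \<Rightarrow> bool" where
  "dual_system S p h \<longleftrightarrow> (\<forall>P\<in>S. \<forall>Q\<in>S. pairing (h P) (p Q) = of_bool (P = Q))"

lemma dual_system_expansion: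
  fixes p :: "'a \<Rightarrow> 'k::field ^ 4"
  assumes S: "finite S" "card S = 4" and "dual_system S p h"
  shows "v = (\<Sum>P\<in>S. pairing (h P) v *s p P)"
proof -
  have ph: "pairing (h P) (p Q) = of_bool (P = Q)" if "P \<in> S" "Q \<in> S" for P Q
    using that assms(3) by (auto simp: dual_system_def)
  have inj: "inj_on p S"
    by (intro inj_onI) (metis ph of_bool_eq_iff)
  have indep: "vec.independent (p ` S)"
  proof (rule vec.independent_if_scalars_zero)
    fix c x assume c: "(\<Sum>x\<in>p ` S. c x *s x) = 0" and "x \<in> p ` S"
    then obtain Q where Q: "Q \<in> S" "x = p Q" by blast
    have "0 = pairing (h Q) (\<Sum>P\<in>S. c (p P) *s p P)"
      using c by (simp add: sum.reindex[OF inj] o_def)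
    also have "\<dots> = (\<Sum>P\<in>S. if P = Q then c (p P) else 0)"
      unfolding pairing_sum_right pairing_scale_right using Q by (intro sum.cong) (auto simp: ph)
    finally show "c x = 0" using Q S by simp
  qed (use S in simp)
  have "card (p ` S) = vec.dim (UNIV :: ('k ^ 4) set)"
    by (simp only: card_image[OF inj] vec_dim_card S(2)) simp
  then have "v \<in> vec.span (p ` S)"
    using vec.card_ge_dim_independent[OF _ indep, of UNIV] by auto
  then show ?thesis
  proof (induction rule: vec.span_induct)
    case base
    show ?case
      by (rule vec.subspaceI)
        (auto simp: vec_eq_iff pairing_add_right pairing_scale_right sum_distrib_left
          distrib_right sum.distrib mult.assoc)
  next
    case (step x)
    then obtain Q where Q: "Q \<in> S" "x = p Q" by blast
    have "(\<Sum>P\<in>S. pairing (h P) x *s p P) = (\<Sum>P\<in>S. if P = Q then p P else 0)"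
      using Q by (intro sum.cong) (auto simp: ph)
    then show ?case using Q S by simp
  qed
qed

lemma euler_dual_system:
  fixes p :: "'a \<Rightarrow> 'k::field ^ 4"
  assumes S: "finite S" "card S = 4" "dual_system S p h" and f: "f \<in> homog t"
  shows "(\<Sum>P\<in>S. dual_form (p P) * dir_deriv (h P) f) = of_nat t * f"
proof -
  have delta: "(\<Sum>P\<in>S. h P $ i * p P $ j) = of_bool (i = j)" for i j
  proof -
    have "(axis i 1 :: 'k ^ 4) $ j = (\<Sum>P\<in>S. pairing (h P) (axis i 1) *s p P) $ j"
      using dual_system_expansion[OF S, of "axis i 1"] by simp
    moreover have "pairing (h P) (axis i 1) = h P $ i" for P
      using pairing_axis[of i "h P"] by (simp add: pairing_def mult.commute)
    ultimately show ?thesis by (simp add: axis_def of_bool_def eq_commute)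
  qed
  have "(\<Sum>P\<in>S. dual_form (p P) * dir_deriv (h P) f) =
      (\<Sum>P\<in>S. \<Sum>j\<in>UNIV. \<Sum>i\<in>UNIV. Const (h P $ i * p P $ j) * (Var j * partial_deriv i f))"
    unfolding dual_form_eq dir_deriv_def sum_product Const_mult by (intro sum.cong refl) (simp add: mult_ac)
  also have "\<dots> = (\<Sum>j\<in>UNIV. \<Sum>i\<in>UNIV. \<Sum>P\<in>S. Const (h P $ i * p P $ j) * (Var j * partial_deriv i f))"
    by (subst sum.swap, subst (2) sum.swap) (rule refl)
  also have "\<dots> = (\<Sum>j\<in>UNIV. \<Sum>i\<in>UNIV. Const (\<Sum>P\<in>S. h P $ i * p P $ j) * (Var j * partial_deriv i f))"
    unfolding Const_sum sum_distrib_right by (rule refl)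
  also have "\<dots> = (\<Sum>j\<in>UNIV. \<Sum>i\<in>UNIV. if i = j then Var j * partial_deriv i f else 0)"
    unfolding delta by (intro sum.cong) auto
  also have "\<dots> = of_nat t * f"
    using euler[OF f] by simp
  finally show ?thesis .
qed

text \<open>Entries of \<open>Ps\<close> equal to \<open>Q\<close> lower the exponent and keep the
  index of the coefficient; each of the others lowers the index, and at least \<open>n\<close> of
  these are present.\<close>

lemma fold_dual_derivs_power_zero:
  assumes "dual_system S p h" "Q \<in> S" "set Ps \<subseteq> S" "g \<in> homog_pred n"
    and "count_list Ps Q \<le> e" "n + count_list Ps Q \<le> length Ps"
  shows "fold dir_deriv (map h Ps) (g * dual_form (p Q) ^ e) = 0"
  using assms(3-)
proof (induction Ps arbitrary: g n e)
  case (Cons P Ps)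
  show ?case
  proof (cases "P = Q")
    case True
    then obtain e' where e: "e = Suc e'" using Cons.prems(3) by (cases e) auto
    then show ?thesis
      using Cons.prems True Cons.IH[OF _ homog_pred_twisted[OF Cons.prems(2)], of e']
      by (simp add: dir_deriv_mult_power del: power_Suc of_nat_Suc)
  next
    case False
    then have "pairing (h P) (p Q) = 0"
      using assms(1,2) Cons.prems(1) by (simp add: dual_system_def)
    moreover have "n - 1 + count_list Ps Q \<le> length Ps"
      using Cons.prems(4) False count_le_length[of Ps Q] by auto
    ultimately show ?thesis
      using Cons.prems False Cons.IH[OF _ dir_deriv_homog_pred[OF Cons.prems(2)], of e]
      by (simp add: dir_deriv_mult_power_zero)
  qed
qed simp

lemma fold_dir_deriv_homog:
  assumes "f \<in> homog t" "t < length hs"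
  shows "fold dir_deriv hs f = 0"
proof -
  have "fold dir_deriv hs f \<in> homog_pred (n - length hs)" if "f \<in> homog_pred n" for f n and hs :: "('a ^ 4) list"
    using that
  proof (induction hs arbitrary: f n)
    case (Cons h hs)
    then show ?case using Cons.IH[OF dir_deriv_homog_pred[OF Cons.prems, of h]] by simp
  qed simp
  from this[of f "Suc t" hs] show ?thesis using assms by simp
qed

text \<open>Each occurrence of \<open>P\<close> in \<open>Ps\<close> may fall on the form instead;
  the derivative already applied to \<open>f\<close> takes its place, so every such term is the full
  derivative of \<open>f\<close>.\<close>

lemma fold_dual_derivs_form_mult:
  assumes "dual_system S p h" "P \<in> S" "set Ps \<subseteq> S"
  shows "fold dir_deriv (map h Ps) (dual_form (p P) * dir_deriv (h P) f) =
     dual_form (p P) * fold dir_deriv (map h Ps) (dir_deriv (h P) f)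
     + of_nat (count_list Ps P) * fold dir_deriv (map h Ps) f"
  using assms(3)
proof (induction Ps arbitrary: f)
  case (Cons Q Ps)
  have "dir_deriv (h Q) (dual_form (p P) * dir_deriv (h P) f) =
      of_bool (Q = P) * dir_deriv (h Q) f + dual_form (p P) * dir_deriv (h P) (dir_deriv (h Q) f)"
    using Cons.prems assms(1,2)
    by (auto simp: dir_deriv_mult dir_deriv_dual_form dual_system_def dir_deriv_commute)
  then show ?case
    using Cons.IH[of "dir_deriv (h Q) f"] Cons.prems
    by (auto simp: fold_dir_deriv_add dir_deriv_commute[of "h Q"] algebra_simps)
qed simp

text \<open>Allowing different exponents makes induction on the degree possible: differentiation along
  \<open>h P\<close> lowers the exponent of \<open>P\<close>, and multiplication by the form of \<open>P\<close> restores it.\<close>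

lemma power_ideal_membership:
  fixes p :: "'a \<Rightarrow> 'k::field_char_0 ^ 4"
  assumes S: "finite S" "card S = 4" "dual_system S p h"
    and f: "f \<in> homog t"
    and zero: "\<And>Ps. set Ps \<subseteq> S \<Longrightarrow> length Ps = t \<Longrightarrow> \<forall>P\<in>S. count_list Ps P < d P \<Longrightarrow>
      fold dir_deriv (map h Ps) f = 0"
  shows "\<exists>g. f = (\<Sum>P\<in>S. g P * dual_form (p P) ^ d P)"
  using f zero
proof (induction t arbitrary: f d)
  case t: (0 f d)
  \<comment> \<open>An exponent 0 puts 1 into the ideal; with all exponents positive the empty list
    is admissible and gives \<open>f = 0\<close>.\<close>
  show ?case
  proof (cases "\<exists>P\<in>S. d P = 0")
    case True
    then obtain P where "P \<in> S" "d P = 0" by blast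
    then show ?thesis
      using S(1) by (intro exI[of _ "\<lambda>Q. if Q = P then f else 0"])
        (simp add: if_distrib[of "\<lambda>x. x * _"] cong: if_cong)
  next
    case False
    then have "f = 0" using t(2)[of "[]"] by simp
    then show ?thesis by (intro exI[of _ "\<lambda>_. 0"]) simp
  qed
next
  case (Suc t)
  show ?case
  proof (cases "\<exists>P\<in>S. d P = 0")
    case True
    then obtain P where "P \<in> S" "d P = 0" by blast
    then show ?thesis
      using S(1) by (intro exI[of _ "\<lambda>Q. if Q = P then f else 0"])
        (simp add: if_distrib[of "\<lambda>x. x * _"] cong: if_cong)
  next
    case False
    have "\<exists>g. dual_form (p P) * dir_deriv (h P) f = (\<Sum>Q\<in>S. g Q * dual_form (p Q) ^ d Q)" if P: "P \<in> S" for P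
    proof -
      obtain e where e: "d P = Suc e" using False P not0_implies_Suc by blast
      have "\<exists>g. dir_deriv (h P) f = (\<Sum>Q\<in>S. g Q * dual_form (p Q) ^ (d(P := e)) Q)"
      proof (rule Suc.IH)
        show "dir_deriv (h P) f \<in> homog t"
          using dir_deriv_homog_pred[of f "Suc (Suc t)" "h P"] Suc.prems(1) by simp
        fix Ps assume Ps: "set Ps \<subseteq> S" "length Ps = t" "\<forall>Q\<in>S. count_list Ps Q < (d(P := e)) Q"
        then have "fold dir_deriv (map h (P # Ps)) f = 0"
          using P e by (intro Suc.prems(2)) (auto split: if_splits)
        then show "fold dir_deriv (map h Ps) (dir_deriv (h P) f) = 0" by simp
      qed
      then obtain g where g: "dir_deriv (h P) f = (\<Sum>Q\<in>S. g Q * dual_form (p Q) ^ (d(P := e)) Q)" ..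
      have "dual_form (p P) * dir_deriv (h P) f =
          (\<Sum>Q\<in>S. (if Q = P then g Q else dual_form (p P) * g Q) * dual_form (p Q) ^ d Q)"
        unfolding g sum_distrib_left by (intro sum.cong) (auto simp: e mult_ac)
      then show ?thesis by (rule exI[where x = "\<lambda>Q. if Q = P then g Q else dual_form (p P) * g Q"])
    qed
    then have "\<forall>P\<in>S. \<exists>g. dual_form (p P) * dir_deriv (h P) f = (\<Sum>Q\<in>S. g Q * dual_form (p Q) ^ d Q)"
      by blast
    from bchoice[OF this] obtain g where
      g: "\<And>P. P \<in> S \<Longrightarrow> dual_form (p P) * dir_deriv (h P) f = (\<Sum>Q\<in>S. g P Q * dual_form (p Q) ^ d Q)"
      by blast
    have "of_nat (Suc t) * f = (\<Sum>P\<in>S. \<Sum>Q\<in>S. g P Q * dual_form (p Q) ^ d Q)"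
      using euler_dual_system[OF S Suc.prems(1)] g by simp
    also have "\<dots> = (\<Sum>Q\<in>S. (\<Sum>P\<in>S. g P Q) * dual_form (p Q) ^ d Q)"
      unfolding sum_distrib_right by (rule sum.swap)
    finally have *: "of_nat (Suc t) * f = (\<Sum>Q\<in>S. (\<Sum>P\<in>S. g P Q) * dual_form (p Q) ^ d Q)" .
    have "(of_nat (Suc t) :: 'k) \<noteq> 0" by (simp del: of_nat_Suc)
    from Const_inverse_mult_cancel[OF this, of f, unfolded Const_of_nat *, symmetric]
    have "f = (\<Sum>Q\<in>S. (Const (inverse (of_nat (Suc t))) * (\<Sum>P\<in>S. g P Q)) * dual_form (p Q) ^ d Q)"
      by (subst (asm) sum_distrib_left) (simp only: mult.assoc)
    then show ?thesis
      by (rule exI[where x = "\<lambda>Q. Const (inverse (of_nat (Suc t))) * (\<Sum>P\<in>S. g P Q)"])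
  qed
qed

text \<open>In the dual coordinates the ideal is generated by the \<open>d\<close>-th powers of the
  four variables; the socle of the quotient sits in degree 4 (d - 1), which exceeds \<open>t\<close>
  under these bounds.\<close>

lemma four_points_Var_mult:
  fixes p :: "'a \<Rightarrow> 'k::field_char_0 ^ 4"
  assumes S: "finite S" "card S = 4" "dual_system S p h"
    and f: "f \<in> homog t" "t + 2 = d + m" "\<And>i. Var i * f \<in> power_comb S p d m"
    and d: "2 \<le> d" "t + 2 \<le> 2 * d"
  shows "\<exists>g. f = (\<Sum>P\<in>S. g P * dual_form (p P) ^ d)"
proof (rule power_ideal_membership[OF S f(1)])
  fix Ps assume Ps: "set Ps \<subseteq> S" "length Ps = t" "\<forall>P\<in>S. count_list Ps P < d"
  \<comment> \<open>Four multiplicities of at least \<open>d - 1\<close> would add up to 4 (d - 1) >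
    t, so one of them can still be raised.\<close>
  have "\<exists>P\<in>S. Suc (count_list Ps P) < d"
  proof (rule ccontr)
    assume "\<not> ?thesis"
    then have "(\<Sum>P\<in>S. d - 1) \<le> (\<Sum>P\<in>S. count_list Ps P)"
      by (intro sum_mono) auto
    also have "\<dots> = t" using sum_count_set[OF Ps(1) S(1)] Ps(2) by simp
    finally show False using S(2) d by simp
  qed
  then obtain P where P: "P \<in> S" "Suc (count_list Ps P) < d" by blast
  have "dual_form (p P) * f \<in> power_comb S p d m"
    unfolding dual_form_eq sum_distrib_right mult.assoc
    by (intro power_comb_sum power_comb_Const_mult f(3))
  then obtain g where g: "dual_form (p P) * f = (\<Sum>Q\<in>S. g Q * dual_form (p Q) ^ d)"
      "\<And>Q. Q \<in> S \<Longrightarrow> g Q \<in> homog_pred m"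
    by (elim power_combE) blast
  \<comment> \<open>With \<open>P\<close> added all multiplicities stay below \<open>d\<close>: at
    most \<open>d - 1\<close> of the t + 1 = m + (d - 1) derivatives belong to \<open>Q\<close>, and
    at least \<open>m\<close> hit the coefficient.\<close>
  have "fold dir_deriv (map h (P # Ps)) (g Q * dual_form (p Q) ^ d) = 0" if "Q \<in> S" for Q
  proof (rule fold_dual_derivs_power_zero[OF S(3) that _ g(2)[OF that]])
    show "set (P # Ps) \<subseteq> S" using P Ps by simp
    have "count_list (P # Ps) Q < d" using P Ps(3) that by auto
    then show "count_list (P # Ps) Q \<le> d" "m + count_list (P # Ps) Q \<le> length (P # Ps)"
      using f(2) Ps(2) by (simp_all del: count_list.simps)
  qed
  then have "0 = fold dir_deriv (map h (P # Ps)) (dual_form (p P) * f)"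
    by (simp add: g(1) fold_dir_deriv_sum del: fold.simps list.map)
  also have "\<dots> = fold dir_deriv (map h Ps) (f + dual_form (p P) * dir_deriv (h P) f)"
    using S(3) P(1) by (simp add: dir_deriv_mult dir_deriv_dual_form dual_system_def)
  also have "\<dots> = fold dir_deriv (map h Ps) f + (dual_form (p P) * fold dir_deriv (map h (P # Ps)) f
      + of_nat (count_list Ps P) * fold dir_deriv (map h Ps) f)"
    unfolding fold_dir_deriv_add fold_dual_derivs_form_mult[OF S(3) P(1) Ps(1)] by simp
  also have "fold dir_deriv (map h (P # Ps)) f = 0"
    using f(1) Ps(2) by (intro fold_dir_deriv_homog) auto
  \<comment> \<open>Pulling the form through counts \<open>P\<close> itself and every
    \<open>P\<close> in \<open>Ps\<close>; the remaining term carries more derivatives than the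
    degree of \<open>f\<close>.\<close>
  finally have "of_nat (Suc (count_list Ps P)) * fold dir_deriv (map h Ps) f = 0"
    by (simp add: algebra_simps)
  then show "fold dir_deriv (map h Ps) f = 0"
    by (simp flip: Const_of_nat del: of_nat_Suc)
qed

subsection \<open>Lines on a smooth quadric\<close>

definition monomial_value :: "'l::field ^ 4 \<Rightarrow> (4 \<Rightarrow>\<^sub>0 nat) \<Rightarrow> 'l" where
  "monomial_value v m = (\<Prod>i\<in>UNIV. (v $ i) ^ Poly_Mapping.lookup m i)"

lemma monomial_value_add: "monomial_value v (m + n) = monomial_value v m * monomial_value v n"
  by (simp add: monomial_value_def lookup_add power_add prod.distrib)

lemma monomial_value_single [simp]: "monomial_value v (Poly_Mapping.single i 1) = v $ i"
proof -
  have "monomial_value v (Poly_Mapping.single i 1) = (\<Prod>j\<in>UNIV. if j = i then v $ j else 1)"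
    unfolding monomial_value_def by (intro prod.cong) (auto simp: lookup_single when_def)
  then show ?thesis by simp
qed

lemma eval_with_eq_sum:
  assumes "finite S" "Poly_Mapping.keys f \<subseteq> S" "h 0 = 0"
  shows "eval_with h f v = (\<Sum>m\<in>S. h (Poly_Mapping.lookup f m) * monomial_value v m)"
proof -
  have "eval_with h f v = (\<Sum>m\<in>Poly_Mapping.keys f. h (Poly_Mapping.lookup f m) * monomial_value v m)"
    by (simp only: eval_with_def monomial_value_def)
  also have "\<dots> = (\<Sum>m\<in>S. h (Poly_Mapping.lookup f m) * monomial_value v m)"
    using assms(1,2)
  proof (rule sum.mono_neutral_left)
    show "\<forall>m\<in>S - Poly_Mapping.keys f. h (Poly_Mapping.lookup f m) * monomial_value v m = 0"
      by (simp add: in_keys_iff assms(3))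
  qed
  finally show ?thesis .
qed

text \<open>Stated for additive \<open>h\<close>, so that it covers evaluation over the field by
  \<open>id\<close> and over its algebraic closure by \<open>to_ac\<close>.\<close>

lemma eval_with_sum:
  assumes "h 0 = 0" and add: "\<And>x y. h (x + y) = h x + h y"
  shows "eval_with h (\<Sum>x\<in>A. f x) v = (\<Sum>x\<in>A. eval_with h (f x) v)"
proof -
  have "eval_with h (f + g) v = eval_with h f v + eval_with h g v" for f g
  proof -
    let ?S = "Poly_Mapping.keys f \<union> Poly_Mapping.keys g"
    have "eval_with h k v = (\<Sum>m\<in>?S. h (Poly_Mapping.lookup k m) * monomial_value v m)"
      if "k \<in> {f, g, f + g}" for k
      using that keys_add[of f g] assms(1) by (intro eval_with_eq_sum) auto
    then show ?thesis
      by (simp add: lookup_add add distrib_right sum.distrib)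
  qed
  moreover have "eval_with h 0 v = 0" by (simp add: eval_with_def)
  ultimately show ?thesis
    by (induction A rule: infinite_finite_induct) auto
qed

lemma eval_with_single:
  "h 0 = 0 \<Longrightarrow> eval_with h (Poly_Mapping.single m c) v = h c * monomial_value v m"
  by (subst eval_with_eq_sum[of "{m}"]) auto

text \<open>The matrix is half the Hessian. A nonzero vector of its kernel would be a singular
  point: the gradient vanishes there, and so does \<open>F\<close>. Smoothness therefore makes it
  invertible.\<close>

lemma quadric_matrix:
  fixes F :: "'k::field_char_0 poly4"
  assumes "smooth_quadric F"
  obtains A :: "'k ^ 4 ^ 4" where "transpose A = A" "invertible A"
    "\<And>v. eval_with id F v = pairing v (A *v v)"
proof -
  define s where "s i j = Poly_Mapping.lookup (partial_deriv i (partial_deriv j F)) 0" for i j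
  define A :: "'k ^ 4 ^ 4" where "A = (\<chi> i j. s i j / 2)"
  have F: "F \<in> homog 2" using assms by (simp add: smooth_quadric_def)
  have dF: "partial_deriv i F \<in> homog 1" for i
    using partial_deriv_homog_pred[of F "Suc 2" i] F by (simp add: numeral_2_eq_2)
  have ddF: "partial_deriv i (partial_deriv j F) = Const (s i j)" for i j
  proof -
    have "partial_deriv i (partial_deriv j F) \<in> homog 0"
      using partial_deriv_homog_pred[of "partial_deriv j F" "Suc 1" i] dF by simp
    then show ?thesis
      by (elim homog_0_eq_Const) (simp add: s_def, simp add: Const_def)
  qed
  have sym: "s i j = s j i" for i j
    by (simp add: s_def partial_deriv_commute)
  have dF_eq: "partial_deriv i F = (\<Sum>j\<in>UNIV. Poly_Mapping.single (Poly_Mapping.single j 1) (s i j))" for i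
  proof -
    have "partial_deriv i F = (\<Sum>j\<in>UNIV. Var j * Const (s j i))"
      using euler[OF dF, of i] by (simp add: ddF)
    then show ?thesis by (simp add: Var_def Const_def mult_single sym)
  qed
  have F_eq: "F = (\<Sum>i\<in>UNIV. \<Sum>j\<in>UNIV.
      Poly_Mapping.single (Poly_Mapping.single i 1 + Poly_Mapping.single j 1) (s i j / 2))"
  proof -
    have "Const (inverse 2) * (of_nat 2 * F) = Const (inverse 2) * (\<Sum>i\<in>UNIV. Var i * partial_deriv i F)"
      using euler[OF F] by simp
    also have "Const (inverse 2) * (of_nat 2 * F) = F"
      using Const_inverse_mult_cancel[of "2 :: 'k" F] Const_of_nat[of 2, where 'a = 'k] by simp
    finally have F': "F = Const (inverse 2) * (\<Sum>i\<in>UNIV. Var i * partial_deriv i F)" .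
    have "Const (inverse 2) * (Var i * Poly_Mapping.single (Poly_Mapping.single j 1) c) =
        Poly_Mapping.single (Poly_Mapping.single i 1 + Poly_Mapping.single j 1) (c / 2)" for i j and c :: 'k
      by (simp only: Var_def Const_def mult_single add_0_left mult_1_left divide_inverse mult.commute[of c])
    then have "Const (inverse 2) * (\<Sum>i\<in>UNIV. Var i * partial_deriv i F) = (\<Sum>i\<in>UNIV. \<Sum>j\<in>UNIV.
      Poly_Mapping.single (Poly_Mapping.single i 1 + Poly_Mapping.single j 1) (s i j / 2))"
      by (simp only: dF_eq sum_distrib_left)
    with F' show ?thesis by (rule trans)
  qed
  have eval_dF: "eval_with h (partial_deriv i F) v = (\<Sum>j\<in>UNIV. h (s i j) * v $ j)"
    if "h 0 = 0" "\<And>x y. h (x + y) = h x + h y" for h i v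
    unfolding dF_eq using that by (subst eval_with_sum) (auto simp only: eval_with_single monomial_value_single)
  have eval_F: "eval_with h F v = (\<Sum>i\<in>UNIV. \<Sum>j\<in>UNIV. h (s i j / 2) * (v $ i * v $ j))"
    if "h 0 = 0" "\<And>x y. h (x + y) = h x + h y" for h v
    by (subst F_eq) (simp only: eval_with_sum[of h] eval_with_single that monomial_value_add monomial_value_single)
  show thesis
  proof
    show "transpose A = A"
      by (simp add: transpose_def A_def vec_eq_iff sym)
    show eval: "eval_with id F v = pairing v (A *v v)" for v
      by (simp add: eval_F pairing_def A_def matrix_vector_mult_def sum_distrib_left mult_ac)
    have "v = 0" if "A *v v = 0" for v
    proof (rule ccontr)
      assume "v \<noteq> 0"
      define w :: "'k alg_closure ^ 4" where "w = (\<chi> i. to_ac (v $ i))"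
      have "w \<noteq> 0" using \<open>v \<noteq> 0\<close> by (auto simp: w_def vec_eq_iff)
      moreover have "eval_with to_ac F w = to_ac (eval_with id F v)"
        by (simp add: eval_F w_def to_ac_sum)
      then have "eval_with to_ac F w = 0"
        using that by (simp add: eval pairing_def)
      moreover have "eval_with to_ac (partial_deriv i F) w = 0" for i
      proof -
        have "(\<Sum>j\<in>UNIV. s i j * v $ j) = 2 * (A *v v) $ i"
          by (simp add: A_def matrix_vector_mult_def sum_distrib_left)
        also have "\<dots> = 0" using that by simp
        finally have "to_ac (\<Sum>j\<in>UNIV. s i j * v $ j) = 0" by simp
        then show ?thesis by (simp add: eval_dF w_def to_ac_sum)
      qed
      ultimately show False using assms by (auto simp: smooth_quadric_def)
    qed
    then show "invertible A"
      by (simp add: invertible_left_inverse matrix_left_invertible_ker)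
  qed
qed

section \<open>Points and lines as subspaces\<close>

lemma proj_line_eq_span:
  assumes "proj_line L" "p \<in> L" "p \<noteq> 0" "q \<in> L" "q \<notin> vec.span {p}"
  shows "L = vec.span {p, q}"
proof
  have "p \<noteq> q" using assms(5) vec.span_base[of p "{p}"] by auto
  moreover have "q \<notin> vec.span {p} \<Longrightarrow> vec.independent {q, p}"
    using assms(3) by (simp add: vec.independent_insert)
  ultimately have "vec.independent {p, q}" "card {p, q} = 2"
    using assms(5) by (auto simp: insert_commute)
  then show "L \<subseteq> vec.span {p, q}"
    using assms by (intro vec.card_ge_dim_independent) (auto simp: proj_line_def)
  show "vec.span {p, q} \<subseteq> L"
    using assms by (intro vec.span_minimal) (auto simp: proj_line_def)
qed

lemma proj_line_basis:
  assumes "proj_line L" "p \<in> L" "p \<noteq> 0"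
  obtains q where "q \<in> L" "q \<notin> vec.span {p}" "L = vec.span {p, q}"
proof -
  have "\<not> L \<subseteq> vec.span {p}"
    using vec.dim_le_card[of L "{p}"] assms(1) by (auto simp: proj_line_def)
  then show thesis
    using that proj_line_eq_span[OF assms] by blast
qed

lemma proj_line_nonzero:
  assumes "proj_line L"
  obtains p where "p \<in> L" "p \<noteq> 0"
proof -
  have "\<not> L \<subseteq> {0}"
    using vec.dim_le_card[of L "{}"] assms unfolding proj_line_def vec.span_empty by force
  then show thesis using that by auto
qed

lemma proj_line_span:
  assumes "p \<noteq> 0" "q \<notin> vec.span {p}"
  shows "proj_line (vec.span {p, q})"
proof -
  have "p \<noteq> q" using assms(2) vec.span_base[of p "{p}"] by auto
  have "vec.independent {q, p}"
    using assms by (simp add: vec.independent_insert)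
  then have "vec.dim (vec.span {q, p}) = card {q, p}"
    by (rule vec.dim_span_eq_card_independent)
  then show ?thesis
    using \<open>p \<noteq> q\<close> by (simp add: proj_line_def insert_commute)
qed

lemma proj_point_span: "p \<noteq> 0 \<Longrightarrow> proj_point (vec.span {p})"
  using vec.dim_span_eq_card_independent[of "{p}"] by (simp add: proj_point_def)

lemma proj_point_eq_span:
  assumes "proj_point P" "p \<in> P" "p \<noteq> 0"
  shows "P = vec.span {p}"
proof
  show "P \<subseteq> vec.span {p}"
    using assms by (intro vec.card_ge_dim_independent) (auto simp: proj_point_def)
  show "vec.span {p} \<subseteq> P"
    using assms by (intro vec.span_minimal) (auto simp: proj_point_def)
qed

lemma proj_point_nonzero:
  assumes "proj_point P"
  obtains p where "p \<in> P" "p \<noteq> 0"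
proof -
  have "\<not> P \<subseteq> {0}"
    using vec.dim_le_card[of P "{}"] assms unfolding proj_point_def vec.span_empty by force
  then show thesis using that by auto
qed

lemma dim_UNIV_4: "vec.dim (UNIV :: ('k::field ^ 4) set) = 4"
  by (simp only: vec_dim_card) simp

lemma independent_4_span:
  fixes B :: "('k::field ^ 4) set"
  assumes "vec.independent B" "card B = 4"
  shows "vec.span B = UNIV"
proof -
  have "vec.dim (UNIV :: ('k ^ 4) set) \<le> card B"
    unfolding dim_UNIV_4 assms(2) by (rule order_refl)
  from vec.card_ge_dim_independent[OF subset_UNIV assms(1) this] show ?thesis
    by blast
qed

lemma independent_3:
  fixes p :: "'k::field ^ 4"
  assumes "p \<noteq> 0" "l \<notin> vec.span {p}" "m \<notin> vec.span {l, p}"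
  shows "vec.independent {m, l, p}" "card {m, l, p} = 3"
proof -
  have "l \<noteq> p" "m \<notin> {l, p}"
    using assms vec.span_base[of p "{p}"] vec.span_base[of m "{l, p}"] by auto
  then show "card {m, l, p} = 3" by simp
  show "vec.independent {m, l, p}"
    using assms \<open>l \<noteq> p\<close> \<open>m \<notin> {l, p}\<close> by (simp add: vec.independent_insert)
qed

lemma span_4:
  fixes p :: "'k::field ^ 4"
  assumes "p \<noteq> 0" "l \<notin> vec.span {p}" "m \<notin> vec.span {l, p}" "n \<notin> vec.span {m, l, p}"
  shows "vec.span {n, m, l, p} = UNIV"
proof (rule independent_4_span)
  have n: "n \<notin> {m, l, p}" using assms(4) vec.span_base[of n "{m, l, p}"] by blast
  then show "card {n, m, l, p} = 4" using independent_3(2)[OF assms(1-3)] by simp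
  show "vec.independent {n, m, l, p}"
    using independent_3(1)[OF assms(1-3)] assms(4) n by (simp add: vec.independent_insert[of n])
qed

lemma pairing_add_left: "pairing (x + y) v = pairing x v + pairing y v"
  by (simp add: pairing_def distrib_right sum.distrib)

lemma pairing_scale_left: "pairing (c *s x) v = c * pairing x v"
  by (simp add: pairing_def sum_distrib_left mult_ac)

lemma pairing_commute: "pairing v w = pairing w v"
  by (simp add: pairing_def mult.commute)

section \<open>The bilinear form and its isotropic lines\<close>

locale quadratic_form =
  fixes A :: "'k::field_char_0 ^ 4 ^ 4"
  assumes symmetric: "transpose A = A" and nondegenerate: "invertible A"
begin

definition bil :: "'k ^ 4 \<Rightarrow> 'k ^ 4 \<Rightarrow> 'k" where
  "bil u v = pairing u (A *v v)"

lemma bil_add_left: "bil (x + y) z = bil x z + bil y z"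
  and bil_scale_left: "bil (c *s x) z = c * bil x z"
  by (simp_all add: bil_def pairing_add_left pairing_scale_left)

lemma bil_commute: "bil x y = bil y x"
proof -
  have "bil x y = (\<Sum>i\<in>UNIV. \<Sum>j\<in>UNIV. x $ i * A $ i $ j * y $ j)" for x y
    by (simp add: bil_def pairing_def matrix_vector_mult_def sum_distrib_left mult_ac)
  then have "bil y x = (\<Sum>i\<in>UNIV. \<Sum>j\<in>UNIV. y $ i * A $ i $ j * x $ j)"
    and "bil x y = (\<Sum>j\<in>UNIV. \<Sum>i\<in>UNIV. x $ i * A $ i $ j * y $ j)"
    by (simp, subst sum.swap, simp)
  then show ?thesis
    using symmetric_matrix_entry[OF symmetric] by (simp add: mult_ac)
qed

lemma bil_add_right: "bil z (x + y) = bil z x + bil z y"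
  and bil_scale_right: "bil z (c *s x) = c * bil z x"
  by (simp_all add: bil_commute[of z] bil_add_left bil_scale_left)

lemma bil_zero [simp]: "bil 0 x = 0" "bil x 0 = 0"
  by (simp_all add: bil_def matrix_vector_mult_0_right pairing_def)

lemma bil_span_zero:
  assumes "x \<in> vec.span B" "\<forall>b\<in>B. bil b y = 0"
  shows "bil x y = 0"
  using assms(1)
proof (induction rule: vec.span_induct)
  case base
  show ?case by (rule vec.subspaceI) (auto simp: bil_add_left bil_scale_left)
qed (use assms(2) in blast)

text \<open>Pairing with the standard basis shows \<open>A *v y = 0\<close>; in this form
  nondegeneracy enters the geometry.\<close>

lemma orthogonal_to_spanning:
  assumes "vec.span B = UNIV" "\<forall>b\<in>B. bil b y = 0"
  shows "y = 0"
proof -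
  have "bil (axis i 1) y = 0" for i
    using bil_span_zero[of "axis i 1" B] assms by simp
  then have "A *v y = 0"
    by (simp add: bil_def pairing_axis vec_eq_iff)
  then show ?thesis
    using nondegenerate by (simp add: invertible_left_inverse matrix_left_invertible_ker)
qed

definition isotropic_line :: "('k ^ 4) set \<Rightarrow> bool" where
  "isotropic_line L \<longleftrightarrow> proj_line L \<and> (\<forall>v\<in>L. bil v v = 0)"

lemma isotropic_line_bil:
  assumes "isotropic_line L" "u \<in> L" "v \<in> L"
  shows "bil u v = 0"
proof -
  have "u + v \<in> L"
    using assms by (auto simp: isotropic_line_def proj_line_def intro: vec.subspace_add)
  then have "bil (u + v) (u + v) = 0" "bil u u = 0" "bil v v = 0"
    using assms by (auto simp: isotropic_line_def)
  then show ?thesis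
    by (simp add: bil_add_left bil_add_right bil_commute[of v u])
qed

lemma isotropic_line_span:
  assumes "p \<noteq> 0" "q \<notin> vec.span {p}" "bil p p = 0" "bil q q = 0" "bil p q = 0"
  shows "isotropic_line (vec.span {p, q})"
proof -
  have "bil v v = 0" if v: "v \<in> vec.span {p, q}" for v
  proof -
    have "bil p v = 0" "bil q v = 0"
      using bil_span_zero[OF v, of p] bil_span_zero[OF v, of q] assms by (auto simp: bil_commute)
    then show ?thesis using bil_span_zero[OF v, of v] by simp
  qed
  then show ?thesis
    using proj_line_span[OF assms(1,2)] by (simp add: isotropic_line_def)
qed

text \<open>Nondegeneracy in dimension four bounds totally isotropic subspaces by dimension two: a
  third independent vector would leave room for a nonzero vector of the span orthogonal to
  everything.\<close>

lemma no_isotropic_3_space: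
  assumes "p \<noteq> 0" "l \<notin> vec.span {p}" "m \<notin> vec.span {l, p}"
    and "bil p p = 0" "bil l l = 0" "bil m m = 0" "bil p l = 0" "bil p m = 0" "bil l m = 0"
  shows False
proof -
  note ind = independent_3[OF assms(1-3)]
  have "vec.span {m, l, p} \<noteq> UNIV"
  proof
    assume "vec.span {m, l, p} = UNIV"
    then have "vec.dim (UNIV :: ('k ^ 4) set) \<le> card {m, l, p}"
      by (intro vec.dim_le_card) auto
    then show False
      unfolding dim_UNIV_4 ind(2) by simp
  qed
  then obtain w where w: "w \<notin> vec.span {m, l, p}" by blast
  have span: "vec.span {w, m, l, p} = UNIV" by (rule span_4[OF assms(1-3) w])
  \<comment> \<open>The combination of \<open>l\<close> and \<open>m\<close> orthogonal to
    \<open>w\<close>, hence to a basis. Being zero, it forces \<open>bil w l = 0\<close>, and then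
    \<open>l\<close> itself is orthogonal to that basis.\<close>
  let ?t = "bil w m *s l + (- bil w l) *s m"
  have "bil p ?t = 0" "bil l ?t = 0" "bil m ?t = 0" "bil w ?t = 0"
    unfolding bil_add_right bil_scale_right using assms(4-) bil_commute[of m l] by simp_all
  then have "?t = 0"
    by (intro orthogonal_to_spanning[OF span]) blast
  have "l \<noteq> 0" using assms(2) vec.span_zero by blast
  have "m \<notin> vec.span {l}"
    using assms(3) vec.span_mono[of "{l}" "{l, p}"] by blast
  have "bil w l = 0"
  proof (rule ccontr)
    assume nz: "bil w l \<noteq> 0"
    have "bil w l *s m = bil w m *s l"
      using \<open>?t = 0\<close> by simp
    then have "bil w l *s m \<in> vec.span {l}"
      using vec.span_scale[OF vec.span_base[of l "{l}"], of "bil w m"] by simp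
    then have "inverse (bil w l) *s (bil w l *s m) \<in> vec.span {l}"
      by (rule vec.span_scale)
    then show False using \<open>m \<notin> vec.span {l}\<close> nz by simp
  qed
  moreover have "bil m l = 0" using assms(9) bil_commute[of m l] by simp
  ultimately have "l = 0"
    using assms(5,7) by (intro orthogonal_to_spanning[OF span]) blast
  then show False using \<open>l \<noteq> 0\<close> by simp
qed

text \<open>The tangent plane at a point cuts the quadric in at most two lines through the point.\<close>

lemma no_three_isotropic_lines:
  assumes L: "isotropic_line L" "p \<in> L" and M: "isotropic_line M" "p \<in> M"
    and N: "isotropic_line N" "p \<in> N" and "p \<noteq> 0" "L \<noteq> M" "L \<noteq> N"
  shows "M = N"
proof (rule ccontr)
  assume "M \<noteq> N"
  have lines: "proj_line L" "proj_line M" "proj_line N"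
    using L M N by (simp_all add: isotropic_line_def)
  obtain l where l: "l \<in> L" "l \<notin> vec.span {p}" "L = vec.span {p, l}"
    using proj_line_basis[OF lines(1) L(2) \<open>p \<noteq> 0\<close>] .
  obtain m where m: "m \<in> M" "m \<notin> vec.span {p}" "M = vec.span {p, m}"
    using proj_line_basis[OF lines(2) M(2) \<open>p \<noteq> 0\<close>] .
  obtain n where n: "n \<in> N" "n \<notin> vec.span {p}" "N = vec.span {p, n}"
    using proj_line_basis[OF lines(3) N(2) \<open>p \<noteq> 0\<close>] .
  have "m \<notin> L"
    using proj_line_eq_span[OF lines(1) L(2) \<open>p \<noteq> 0\<close> _ m(2)] m(3) \<open>L \<noteq> M\<close> by blast
  have "n \<notin> L"
    using proj_line_eq_span[OF lines(1) L(2) \<open>p \<noteq> 0\<close> _ n(2)] n(3) \<open>L \<noteq> N\<close> by blast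
  have "n \<notin> M"
    using proj_line_eq_span[OF lines(2) M(2) \<open>p \<noteq> 0\<close> _ n(2)] n(3) \<open>M \<noteq> N\<close> by blast
  have bil: "bil p p = 0" "bil l l = 0" "bil m m = 0" "bil n n = 0" "bil p l = 0" "bil p m = 0" "bil p n = 0"
    using isotropic_line_bil[OF L(1)] isotropic_line_bil[OF M(1)] isotropic_line_bil[OF N(1)]
      L(2) M(2) N(2) l(1) m(1) n(1) by blast+
  have span: "vec.span {l, p} = L" by (simp add: l(3) insert_commute)
  have m': "m \<notin> vec.span {l, p}" using \<open>m \<notin> L\<close> span by simp
  \<comment> \<open>\<open>p\<close> is orthogonal to \<open>l\<close>, \<open>m\<close>,
    \<open>n\<close> and itself; were the four independent, \<open>p\<close> would vanish.\<close>
  have "n \<in> vec.span {m, l, p}"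
  proof (rule ccontr)
    assume "n \<notin> vec.span {m, l, p}"
    then have "vec.span {n, m, l, p} = UNIV"
      using span_4[OF \<open>p \<noteq> 0\<close> l(2) m'] by blast
    moreover have "bil n p = 0" "bil m p = 0" "bil l p = 0"
      using bil(5-7) by (simp_all only: bil_commute[of n p] bil_commute[of m p] bil_commute[of l p])
    ultimately have "p = 0"
      using bil(1) by (intro orthogonal_to_spanning[of "{n, m, l, p}"]) blast+
    then show False using \<open>p \<noteq> 0\<close> by simp
  qed
  then obtain \<gamma> where "n - \<gamma> *s m \<in> vec.span {l, p}"
    using vec.span_breakdown_eq[of n m "{l, p}"] by blast
  then obtain \<beta> where "n - \<gamma> *s m - \<beta> *s l \<in> vec.span {p}"
    using vec.span_breakdown_eq[of _ l "{p}"] by blast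
  then obtain \<alpha> where "n - \<gamma> *s m - \<beta> *s l = \<alpha> *s p"
    using vec.span_singleton[of p] by blast
  then have n_eq: "n = \<alpha> *s p + \<beta> *s l + \<gamma> *s m"
    by (simp only: diff_eq_eq)
  have sub: "vec.subspace L" "vec.subspace M"
    using lines by (simp_all add: proj_line_def)
  have "\<alpha> *s p + 0 *s l + \<gamma> *s m \<in> M"
    using vec.subspace_add[OF sub(2) vec.subspace_scale[OF sub(2) M(2), of \<alpha>]
      vec.subspace_scale[OF sub(2) m(1), of \<gamma>]] by simp
  then have "\<beta> \<noteq> 0"
    using \<open>n \<notin> M\<close> n_eq by blast
  moreover have "\<alpha> *s p + \<beta> *s l + 0 *s m \<in> L"
    using vec.subspace_add[OF sub(1) vec.subspace_scale[OF sub(1) L(2), of \<alpha>]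
      vec.subspace_scale[OF sub(1) l(1), of \<beta>]] by simp
  then have "\<gamma> \<noteq> 0"
    using \<open>n \<notin> L\<close> n_eq by blast
  \<comment> \<open>Only the cross term survives; both coefficients are nonzero, so \<open>l\<close>
    and \<open>m\<close> are orthogonal and the span of \<open>p\<close>, \<open>l\<close>,
    \<open>m\<close> is totally isotropic.\<close>
  moreover have "bil n n = 2 * \<beta> * \<gamma> * bil l m"
    unfolding n_eq bil_add_left bil_add_right bil_scale_left bil_scale_right
      bil_commute[of m l] bil_commute[of l p] bil_commute[of m p] bil(1-3,5,6)
    by simp
  ultimately have "bil l m = 0" using bil(4) by simp
  then show False
    using no_isotropic_3_space[OF \<open>p \<noteq> 0\<close> l(2) m'] bil by blast
qed

lemma isotropic_line_orthogonal_vector: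
  assumes "isotropic_line L"
  obtains l where "l \<in> L" "l \<noteq> 0" "bil p l = 0"
proof -
  have L: "proj_line L" using assms by (simp add: isotropic_line_def)
  obtain u where u: "u \<in> L" "u \<noteq> 0" using proj_line_nonzero[OF L] .
  obtain v where v: "v \<in> L" "v \<notin> vec.span {u}" using proj_line_basis[OF L u] .
  show thesis
  proof (cases "bil p u = 0")
    case True
    then show ?thesis using that u by blast
  next
    case False
    let ?l = "v + (- bil p v / bil p u) *s u"
    have "?l \<noteq> 0"
    proof
      assume "?l = 0"
      then have "v = (bil p v / bil p u) *s u" by (simp add: vec_eq_iff add_eq_0_iff)
      then show False using v(2) by (metis insertI1 vec.span_base vec.span_scale)
    qed
    moreover have "?l \<in> L"
      using L u v unfolding proj_line_def by (intro vec.subspace_add vec.subspace_scale) auto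
    moreover have "bil p ?l = 0"
      unfolding bil_add_right bil_scale_right using False by simp
    ultimately show ?thesis using that by blast
  qed
qed

end

section \<open>Rulings as families of isotropic lines\<close>

context quadratic_form
begin

text \<open>Points are replaced by nonzero isotropic vectors, so that incidence becomes
  membership.\<close>

definition isotropic_ruling :: "('k ^ 4) set set \<Rightarrow> bool" where
  "isotropic_ruling \<R> \<longleftrightarrow> (\<forall>L\<in>\<R>. isotropic_line L) \<and>
     (\<forall>p. p \<noteq> 0 \<and> bil p p = 0 \<longrightarrow> (\<exists>!L. L \<in> \<R> \<and> p \<in> L))"

lemma isotropic_ruling_if_ruling:
  assumes "ruling F \<R>" "\<And>v. eval_with id F v = bil v v"
  shows "isotropic_ruling \<R>"
  unfolding isotropic_ruling_def
proof (intro conjI ballI allI impI)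
  show "isotropic_line L" if "L \<in> \<R>" for L
    using assms that by (simp add: ruling_def isotropic_line_def on_quadric_def)
  fix p assume p: "p \<noteq> 0 \<and> bil p p = 0"
  have "on_quadric F (vec.span {p})"
    using p by (auto simp: on_quadric_def assms(2) vec.span_singleton bil_scale_left bil_scale_right)
  then have "\<exists>!L. L \<in> \<R> \<and> vec.span {p} \<subseteq> L"
    using assms(1) p proj_point_span[of p] by (simp add: ruling_def)
  moreover have "vec.span {p} \<subseteq> L \<longleftrightarrow> p \<in> L" if "L \<in> \<R>" for L
    using assms(1) that vec.span_base[of p "{p}"] vec.span_minimal[of "{p}" L]
    by (auto simp: ruling_def proj_line_def)
  ultimately show "\<exists>!L. L \<in> \<R> \<and> p \<in> L" by blast
qed

lemma isotropic_rulingD: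
  assumes "isotropic_ruling \<R>"
  shows "L \<in> \<R> \<Longrightarrow> isotropic_line L"
    and "L \<in> \<R> \<Longrightarrow> L' \<in> \<R> \<Longrightarrow> p \<in> L \<Longrightarrow> p \<in> L' \<Longrightarrow> p \<noteq> 0 \<Longrightarrow> L = L'"
    and "p \<noteq> 0 \<Longrightarrow> bil p p = 0 \<Longrightarrow> \<exists>L\<in>\<R>. p \<in> L"
proof -
  show "L \<in> \<R> \<Longrightarrow> isotropic_line L"
    using assms by (simp add: isotropic_ruling_def)
  show "p \<noteq> 0 \<Longrightarrow> bil p p = 0 \<Longrightarrow> \<exists>L\<in>\<R>. p \<in> L"
    using assms unfolding isotropic_ruling_def by blast
  assume *: "L \<in> \<R>" "L' \<in> \<R>" "p \<in> L" "p \<in> L'" "p \<noteq> 0"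
  then have "bil p p = 0"
    using assms by (auto simp: isotropic_ruling_def isotropic_line_def)
  then show "L = L'"
    using * assms unfolding isotropic_ruling_def by blast
qed

text \<open>If \<open>M\<close> missed \<open>L\<close>, then a point \<open>p\<close> of \<open>M\<close> would lie on \<open>M\<close>, on the line of the ruling
  through \<open>p\<close>, and on the isotropic line joining \<open>p\<close> to a point of \<open>L\<close>.\<close>

lemma isotropic_ruling_meets:
  assumes R: "isotropic_ruling \<R>" and L: "L \<in> \<R>" and M: "isotropic_line M" "M \<notin> \<R>"
  obtains x where "x \<in> L" "x \<in> M" "x \<noteq> 0"
proof -
  have "\<exists>x. x \<in> L \<and> x \<in> M \<and> x \<noteq> 0"
  proof (rule ccontr)
    assume none: "\<nexists>x. x \<in> L \<and> x \<in> M \<and> x \<noteq> 0"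
    have isoL: "isotropic_line L" using isotropic_rulingD(1)[OF R L] .
    have "proj_line M" using M by (simp add: isotropic_line_def)
    then obtain p where p: "p \<in> M" "p \<noteq> 0" by (rule proj_line_nonzero)
    have pp: "bil p p = 0" using isotropic_line_bil[OF M(1) p(1) p(1)] .
    obtain K where K: "K \<in> \<R>" "p \<in> K" using isotropic_rulingD(3)[OF R p(2) pp] by blast
    have isoK: "isotropic_line K" using isotropic_rulingD(1)[OF R K(1)] .
    obtain l where l: "l \<in> L" "l \<noteq> 0" "bil p l = 0" using isotropic_line_orthogonal_vector[OF isoL] .
    have "l \<notin> M" using none l by blast
    moreover have "vec.span {p} \<subseteq> M"
      using p M by (intro vec.span_minimal) (auto simp: isotropic_line_def proj_line_def)
    ultimately have lp: "l \<notin> vec.span {p}" by blast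
    have ll: "bil l l = 0" using isotropic_line_bil[OF isoL l(1) l(1)] .
    let ?N = "vec.span {p, l}"
    have N: "isotropic_line ?N" using isotropic_line_span[OF p(2) lp pp ll l(3)] .
    have "p \<in> ?N" "l \<in> ?N" by (auto intro: vec.span_base)
    have "?N \<noteq> M" using \<open>l \<in> ?N\<close> \<open>l \<notin> M\<close> by blast
    moreover have "?N \<noteq> K"
    proof
      assume "?N = K"
      then have "K = L"
        using isotropic_rulingD(2)[OF R K(1) L _ l(1,2)] \<open>l \<in> ?N\<close> by blast
      then show False using none K p by blast
    qed
    ultimately have "M = K"
      using no_three_isotropic_lines[OF N \<open>p \<in> ?N\<close> M(1) p(1) isoK K(2) p(2)] by blast
    then show False using M(2) K(1) by blast
  qed
  then show thesis using that by blast
qed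

text \<open>If the rulings share a line \<open>M\<close>, a line of one outside the other would meet
  \<open>M\<close> by \<open>isotropic_ruling_meets\<close>, although distinct lines of one ruling
  have no common point; so sharing one line forces equality.\<close>

lemma isotropic_rulings_disjoint:
  assumes "isotropic_ruling \<R>" "isotropic_ruling \<R>'" "\<R> \<noteq> \<R>'"
  shows "\<R> \<inter> \<R>' = {}"
proof -
  have "R \<subseteq> R'" if R: "isotropic_ruling R" "isotropic_ruling R'" and M: "M \<in> R" "M \<in> R'" for R R' M
  proof
    fix N assume N: "N \<in> R"
    show "N \<in> R'"
    proof (rule ccontr)
      assume N': "N \<notin> R'"
      obtain x where "x \<in> M" "x \<in> N" "x \<noteq> 0"
        using isotropic_ruling_meets[OF R(2) M(2) isotropic_rulingD(1)[OF R(1) N] N'] .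
      then have "N = M" using isotropic_rulingD(2)[OF R(1) N M(1)] by blast
      then show False using M N' by blast
    qed
  qed
  from this[OF assms(1,2)] this[OF assms(2,1)] assms(3) show ?thesis by blast
qed

lemma isotropic_rulings_meet_in_point:
  assumes R: "isotropic_ruling \<R>" "isotropic_ruling \<R>'" "\<R> \<noteq> \<R>'" and L: "L \<in> \<R>" and M: "M \<in> \<R>'"
  shows "proj_point (L \<inter> M)"
proof -
  have disj: "\<R> \<inter> \<R>' = {}" using isotropic_rulings_disjoint[OF R] .
  then obtain x where x: "x \<in> L" "x \<in> M" "x \<noteq> 0"
    using isotropic_ruling_meets[OF R(1) L isotropic_rulingD(1)[OF R(2) M]] M by blast
  have lines: "proj_line L" "proj_line M"
    using isotropic_rulingD(1)[OF R(1) L] isotropic_rulingD(1)[OF R(2) M] by (simp_all add: isotropic_line_def)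
  have "L \<inter> M = vec.span {x}"
  proof
    show "L \<inter> M \<subseteq> vec.span {x}"
    proof (rule subsetI, rule ccontr)
      fix y assume y: "y \<in> L \<inter> M" "y \<notin> vec.span {x}"
      then have "L = M"
        using proj_line_eq_span[OF lines(1) x(1,3), of y] proj_line_eq_span[OF lines(2) x(2,3), of y] by blast
      then show False using disj L M by blast
    qed
    show "vec.span {x} \<subseteq> L \<inter> M"
      using lines x by (intro vec.span_minimal vec.subspace_inter) (auto simp: proj_line_def)
  qed
  then show ?thesis using proj_point_span[OF x(3)] by simp
qed

end

subsection \<open>Grids\<close>

lemma ex_surj_onto:
  assumes "finite A" "finite B" "card A \<le> card B" "A \<noteq> {}"
  shows "\<exists>f. f ` B = A"
proof -
  from card_le_inj[OF assms(1-3)] obtain g where g: "g ` A \<subseteq> B" "inj_on g A"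
    by (elim exE conjE)
  obtain a where a: "a \<in> A" using assms(4) by blast
  define f where "f x = (if x \<in> g ` A then inv_into A g x else a)" for x
  have "f ` B = A"
  proof
    show "f ` B \<subseteq> A"
      unfolding f_def using a inv_into_into[of _ g A] by auto
    show "A \<subseteq> f ` B"
    proof
      fix x assume "x \<in> A"
      then have "x = f (g x)" "g x \<in> B"
        using g by (auto simp: f_def)
      then show "x \<in> f ` B" by (rule image_eqI)
    qed
  qed
  then show ?thesis by (rule exI[of _ f])
qed

lemma grid_properties:
  fixes G :: "('k::field_char_0 ^ 4) set set"
  assumes ab: "2 \<le> a" "a \<le> b" and grid: "is_grid a b G" and \<rho>: "coord_choice G \<rho>"
  obtains A :: "'k ^ 4 ^ 4" where "finite G" "card G = a * b" "\<forall>P\<in>G. \<rho> P \<noteq> 0" "separates G \<rho> (b - 1)"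
    "transpose A = A" "invertible A" "\<forall>P\<in>G. pairing (\<rho> P) (A *v \<rho> P) = 0"
proof -
  obtain F \<R> \<R>' LS MS where F: "smooth_quadric F" "ruling F \<R>" "ruling F \<R>'" "\<R> \<noteq> \<R>'"
    and LS: "LS \<subseteq> \<R>" "finite LS" "card LS = a" and MS: "MS \<subseteq> \<R>'" "finite MS" "card MS = b"
    and G: "G = {P. proj_point P \<and> (\<exists>L\<in>LS. \<exists>M\<in>MS. P \<subseteq> L \<and> P \<subseteq> M)}"
    using grid unfolding is_grid_def by blast
  have "\<exists>A :: 'k ^ 4 ^ 4. transpose A = A \<and> invertible A \<and> (\<forall>v. eval_with id F v = pairing v (A *v v))"
    by (rule quadric_matrix[OF F(1)]) blast
  then obtain A :: "'k ^ 4 ^ 4" where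
    A: "transpose A = A" "invertible A" "\<And>v. eval_with id F v = pairing v (A *v v)"
    by blast
  interpret quadratic_form A
    by unfold_locales (fact A)+
  have eval: "eval_with id F v = bil v v" for v by (simp add: A(3) bil_def)
  have R: "isotropic_ruling \<R>" "isotropic_ruling \<R>'"
    using isotropic_ruling_if_ruling F(2,3) eval by blast+
  have point: "proj_point (L \<inter> M)" if "L \<in> LS" "M \<in> MS" for L M
    using isotropic_rulings_meet_in_point[OF R F(4), of L M] that LS(1) MS(1) by blast
  have L_eq: "L = L'" if "L \<in> LS" "L' \<in> LS" "x \<in> L" "x \<in> L'" "x \<noteq> 0" for L L' x
    using isotropic_rulingD(2)[OF R(1), of L L' x] that LS(1) by blast
  have M_eq: "M = M'" if "M \<in> MS" "M' \<in> MS" "x \<in> M" "x \<in> M'" "x \<noteq> 0" for M M' x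
    using isotropic_rulingD(2)[OF R(2), of M M' x] that MS(1) by blast
  have LM_neq: "L \<noteq> M" if "L \<in> LS" "M \<in> MS" for L M
    using isotropic_rulings_disjoint[OF R F(4)] that LS(1) MS(1) by blast
  have isoL: "isotropic_line L" if "L \<in> LS" for L
    using isotropic_rulingD(1)[OF R(1)] that LS(1) by blast
  have isoM: "isotropic_line M" if "M \<in> MS" for M
    using isotropic_rulingD(1)[OF R(2)] that MS(1) by blast
  have G_eq: "G = (\<lambda>(L, M). L \<inter> M) ` (LS \<times> MS)"
  proof (intro equalityI subsetI)
    fix P assume "P \<in> G"
    then obtain L M where P: "proj_point P" "L \<in> LS" "M \<in> MS" "P \<subseteq> L \<inter> M"
      unfolding G by blast
    obtain x where x: "x \<in> P" "x \<noteq> 0" using proj_point_nonzero[OF P(1)] .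
    have "x \<in> L \<inter> M" using P(4) x(1) by blast
    then have "P = L \<inter> M"
      using proj_point_eq_span[OF P(1) x] proj_point_eq_span[OF point[OF P(2,3)] _ x(2)] by simp
    then show "P \<in> (\<lambda>(L, M). L \<inter> M) ` (LS \<times> MS)"
      using P(2,3) by (intro image_eqI[of _ _ "(L, M)"]) simp_all
  next
    fix P assume "P \<in> (\<lambda>(L, M). L \<inter> M) ` (LS \<times> MS)"
    then obtain L M where P: "P = L \<inter> M" "L \<in> LS" "M \<in> MS" by auto
    have "P \<subseteq> L" "P \<subseteq> M" using P(1) by simp_all
    then show "P \<in> G"
      unfolding G using point[OF P(2,3)] P by blast
  qed
  have inj: "inj_on (\<lambda>(L, M). L \<inter> M) (LS \<times> MS)"
  proof (rule inj_onI, clarify)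
    fix L M L' M' assume *: "L \<in> LS" "M \<in> MS" "L' \<in> LS" "M' \<in> MS" "L \<inter> M = L' \<inter> M'"
    obtain x where "x \<in> L \<inter> M" "x \<noteq> 0" using proj_point_nonzero[OF point[OF *(1,2)]] .
    then show "L = L' \<and> M = M'" using L_eq[of L L' x] M_eq[of M M' x] * by blast
  qed
  have fin: "finite G" using LS MS by (simp add: G_eq)
  have card: "card G = a * b"
    using LS MS by (simp add: G_eq card_image[OF inj] card_cartesian_product)
  have \<rho>_neq: "\<forall>P\<in>G. \<rho> P \<noteq> 0"
    using \<rho> by (simp add: coord_choice_def)
  define z where "z L M = \<rho> (L \<inter> M)" for L M
  have z: "z L M \<in> L" "z L M \<in> M" "z L M \<noteq> 0" if "L \<in> LS" "M \<in> MS" for L M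
  proof -
    have "L \<inter> M \<in> G" using that by (auto simp: G_eq)
    then have "\<rho> (L \<inter> M) \<in> L \<inter> M" "\<rho> (L \<inter> M) \<noteq> 0" using \<rho> by (auto simp: coord_choice_def)
    then show "z L M \<in> L" "z L M \<in> M" "z L M \<noteq> 0" by (auto simp: z_def)
  qed
  have isotropic: "\<forall>P\<in>G. pairing (\<rho> P) (A *v \<rho> P) = 0"
  proof
    fix P assume "P \<in> G"
    then obtain L M where LM: "L \<in> LS" "M \<in> MS" "P = L \<inter> M" by (auto simp: G_eq)
    then have "bil (z L M) (z L M) = 0" using isotropic_line_bil[OF isoL] z by blast
    then show "pairing (\<rho> P) (A *v \<rho> P) = 0" by (simp add: bil_def z_def LM)
  qed
  have separates: "separates G \<rho> (b - 1)"
    unfolding separates_def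
  proof
    fix P assume "P \<in> G"
    then obtain L M where LM: "L \<in> LS" "M \<in> MS" and P: "P = L \<inter> M" by (auto simp: G_eq)
    have "card (LS - {L}) = a - 1" "card (MS - {M}) = b - 1"
      using LS MS LM by simp_all
    then have cards: "card (LS - {L}) \<le> card (MS - {M})" "card (LS - {L}) \<noteq> 0"
      using ab by simp_all
    then have ne: "LS - {L} \<noteq> {}" by (metis card.empty)
    \<comment> \<open>On each line \<open>N\<close> other than \<open>M\<close> the point of
      tangency lies on \<open>\<sigma> N\<close>; surjectivity makes every line of \<open>LS\<close>
      other than \<open>L\<close> occur.\<close>
    obtain \<sigma> where \<sigma>: "\<sigma> ` (MS - {M}) = LS - {L}"
      using ex_surj_onto[OF finite_Diff[OF LS(2)] finite_Diff[OF MS(2)] cards(1) ne] by blast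
    obtain ms where ms: "set ms = MS - {M}" "distinct ms"
      using finite_distinct_list[OF finite_Diff[OF MS(2), of "{M}"]] by blast
    \<comment> \<open>The normal vector of the tangent plane at the grid point on
      \<open>\<sigma> N\<close> and \<open>N\<close>.\<close>
    let ?h = "\<lambda>N. A *v z (\<sigma> N) N"
    have pairing: "pairing (?h N) x = bil x (z (\<sigma> N) N)" for N x
      unfolding bil_def by (rule pairing_commute)
    have N: "N \<in> MS" "N \<noteq> M" "\<sigma> N \<in> LS" "\<sigma> N \<noteq> L" if "N \<in> set ms" for N
    proof -
      have "N \<in> MS - {M}" using that ms(1) by simp
      moreover from this have "\<sigma> N \<in> LS - {L}" using \<sigma> by blast
      ultimately show "N \<in> MS" "N \<noteq> M" "\<sigma> N \<in> LS" "\<sigma> N \<noteq> L" by simp_all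
    qed
    show "\<exists>hs. length hs = b - 1 \<and> (\<forall>h\<in>set hs. pairing h (\<rho> P) \<noteq> 0) \<and>
        (\<forall>Q\<in>G. Q \<noteq> P \<longrightarrow> (\<exists>h\<in>set hs. pairing h (\<rho> Q) = 0))"
    proof (intro exI conjI ballI impI)
      show "length (map ?h ms) = b - 1"
        using distinct_card[OF ms(2)] ms(1) \<open>card (MS - {M}) = b - 1\<close> by simp
      fix h assume "h \<in> set (map ?h ms)"
      then obtain N where h: "h = ?h N" "N \<in> set ms" by auto
      note N = N[OF h(2)]
      let ?x = "z L M" and ?y = "z (\<sigma> N) N"
      have x: "?x \<notin> \<sigma> N" "?x \<notin> N"
        using L_eq[OF LM(1) N(3) z(1)[OF LM] _ z(3)[OF LM]] M_eq[OF LM(2) N(1) z(2)[OF LM] _ z(3)[OF LM]] N(2,4)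
        by blast+
      note y = z[OF N(3,1)]
      \<comment> \<open>If the tangent plane at \<open>?y\<close> contained \<open>?x\<close>, the
        line joining them would be a third isotropic line through \<open>?y\<close>, besides
        \<open>\<sigma> N\<close> and \<open>N\<close>.\<close>
      show "pairing h (\<rho> P) \<noteq> 0"
      proof
        assume "pairing h (\<rho> P) = 0"
        then have "bil ?x ?y = 0" using pairing[of N ?x] by (simp only: h(1) P z_def)
        then have "bil ?y ?x = 0" by (subst bil_commute)
        moreover have "vec.span {?y} \<subseteq> N"
          using y isoM[OF N(1)] by (intro vec.span_minimal) (auto simp: isotropic_line_def proj_line_def)
        then have "?x \<notin> vec.span {?y}" using x by blast
        moreover have "bil ?x ?x = 0" "bil ?y ?y = 0"
          using isotropic_line_bil[OF isoL[OF LM(1)]] isotropic_line_bil[OF isoM[OF N(1)]] z[OF LM] y by blast+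
        ultimately have K: "isotropic_line (vec.span {?y, ?x})"
          using y(3) by (intro isotropic_line_span)
        have "?x \<in> vec.span {?y, ?x}" "?y \<in> vec.span {?y, ?x}" by (auto intro: vec.span_base)
        then have "\<sigma> N = N"
          using no_three_isotropic_lines[OF K _ isoL[OF N(3)] y(1) isoM[OF N(1)] y(2,3)] x by blast
        then show False using LM_neq N by blast
      qed
    next
      fix Q assume "Q \<in> G" "Q \<noteq> P"
      then obtain L' M' where Q: "L' \<in> LS" "M' \<in> MS" "Q = L' \<inter> M'" by (auto simp: G_eq)
      \<comment> \<open>Off \<open>M\<close>, the tangent plane at the point chosen on
        \<open>M'\<close> contains all of \<open>M'\<close>; on \<open>M\<close>, the line
        \<open>L'\<close> differs from \<open>L\<close> and is some
        \<open>\<sigma> N\<close>.\<close>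
      have "\<exists>N\<in>set ms. bil (z L' M') (z (\<sigma> N) N) = 0"
      proof (cases "M' = M")
        case False
        then have "M' \<in> set ms" using Q ms by blast
        then show ?thesis
          using isotropic_line_bil[OF isoM[OF Q(2)] z(2)[OF Q(1,2)] z(2)[OF N(3,1)]] by blast
      next
        case True
        then have "L' \<in> LS - {L}" using Q P \<open>Q \<noteq> P\<close> by blast
        then obtain N where N': "N \<in> set ms" "\<sigma> N = L'" using \<sigma> ms(1) by (metis imageE)
        then have "z (\<sigma> N) N \<in> L'" using z(1)[OF N(3,1)] by blast
        then show ?thesis
          using isotropic_line_bil[OF isoL[OF Q(1)] z(1)[OF Q(1,2)]] N'(1) by blast
      qed
      then obtain N where N': "N \<in> set ms" "bil (z L' M') (z (\<sigma> N) N) = 0" by blast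
      then have "pairing (?h N) (\<rho> Q) = 0"
        using pairing[of N "z L' M'"] by (simp only: Q(3) z_def)
      then show "\<exists>h\<in>set (map ?h ms). pairing h (\<rho> Q) = 0"
        using N'(1) by (intro bexI[of _ "?h N"]) simp_all
    qed
  qed
  show thesis
    by (rule that[OF fin card \<rho>_neq separates A(1,2) isotropic])
qed

text \<open>With a single plane per point, its normal vector pairs to zero with all other points;
  rescaling gives the dual basis.\<close>

lemma separates_one_dual_system:
  fixes p :: "'a \<Rightarrow> 'k::field ^ 4"
  assumes "separates S p 1"
  obtains h where "dual_system S p h"
proof -
  have "\<exists>h. pairing h (p P) = 1 \<and> (\<forall>Q\<in>S. Q \<noteq> P \<longrightarrow> pairing h (p Q) = 0)" if P: "P \<in> S" for P
  proof -
    obtain hs where hs: "length hs = 1" "\<forall>h\<in>set hs. pairing h (p P) \<noteq> 0"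
      "\<forall>Q\<in>S. Q \<noteq> P \<longrightarrow> (\<exists>h\<in>set hs. pairing h (p Q) = 0)"
      using assms P unfolding separates_def by blast
    then obtain h where "hs = [h]" by (auto simp: length_Suc_conv)
    then have "pairing h (p P) \<noteq> 0" "\<forall>Q\<in>S. Q \<noteq> P \<longrightarrow> pairing h (p Q) = 0" using hs by auto
    then show ?thesis
      by (intro exI[of _ "inverse (pairing h (p P)) *s h"]) (simp add: pairing_scale_left)
  qed
  then have "\<forall>P\<in>S. \<exists>h. pairing h (p P) = 1 \<and> (\<forall>Q\<in>S. Q \<noteq> P \<longrightarrow> pairing h (p Q) = 0)" by blast
  from bchoice[OF this] obtain h where "\<forall>P\<in>S. pairing (h P) (p P) = 1 \<and> (\<forall>Q\<in>S. Q \<noteq> P \<longrightarrow> pairing (h P) (p Q) = 0)"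
    by blast
  then have "dual_system S p h" by (auto simp: dual_system_def)
  then show thesis by (rule that)
qed

subsection \<open>The socle\<close>

lemma residue_class_eq_zero_iff:
  assumes "finite G"
  shows "residue_class (Lambda \<rho> G d) f = residue_class (Lambda \<rho> G d) 0 \<longleftrightarrow> f \<in> Lambda \<rho> G d"
proof
  assume "residue_class (Lambda \<rho> G d) f = residue_class (Lambda \<rho> G d) 0"
  moreover have "f \<in> residue_class (Lambda \<rho> G d) f"
    using Lambda_closed(1)[OF assms] by (simp add: residue_class_def)
  ultimately show "f \<in> Lambda \<rho> G d"
    by (simp add: residue_class_def)
next
  assume f: "f \<in> Lambda \<rho> G d"
  have "g - f \<in> Lambda \<rho> G d \<longleftrightarrow> g \<in> Lambda \<rho> G d" for g
    using Lambda_closed(2)[OF assms, of "g - f" \<rho> d f] f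
      Lambda_closed(2)[OF assms, of g \<rho> d "(- 1) * f"] Lambda_closed(3)[OF assms, of f \<rho> d "- 1"] by auto
  then show "residue_class (Lambda \<rho> G d) f = residue_class (Lambda \<rho> G d) 0"
    by (simp add: residue_class_def)
qed

text \<open>A class in the intersection has one representative from the socle condition and another
  that is homogeneous. They differ by an element of the ideal, so the second satisfies the socle
  condition too, and \<open>key\<close> applies to it.\<close>

lemma socle_component_zero:
  assumes G: "finite G"
    and key: "\<And>f. f \<in> homog t \<Longrightarrow> (\<And>i. Var i * f \<in> Lambda \<rho> G d) \<Longrightarrow> f \<in> Lambda \<rho> G d"
  shows "socle (Lambda \<rho> G d) \<inter> quotient_component (Lambda \<rho> G d) t = {residue_class (Lambda \<rho> G d) 0}"
    (is "?S \<inter> ?Q = {?c 0}")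
proof
  note zero_iff = residue_class_eq_zero_iff[OF G, of \<rho> d]
  show "?S \<inter> ?Q \<subseteq> {?c 0}"
  proof
    fix C assume "C \<in> ?S \<inter> ?Q"
    then obtain f g where f: "C = ?c f" "\<And>i. ?c (Var i * f) = ?c 0" and g: "C = ?c g" "g \<in> homog t"
      unfolding socle_def quotient_component_def by blast
    have "g \<in> ?c f"
      using f(1) g(1) Lambda_closed(1)[OF G] by (auto simp: residue_class_def)
    then have gf: "g - f \<in> Lambda \<rho> G d" by (simp add: residue_class_def)
    have "Var i * g \<in> Lambda \<rho> G d" for i
    proof -
      have "Var i * f \<in> Lambda \<rho> G d" using f(2) zero_iff by blast
      from Lambda_closed(2)[OF G this Lambda_closed(3)[OF G gf, of "Var i"]] show ?thesis
        by (simp add: right_diff_distrib)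
    qed
    then have "g \<in> Lambda \<rho> G d" using key g(2) by blast
    then show "C \<in> {?c 0}" using g(1) zero_iff by blast
  qed
  show "{?c 0} \<subseteq> ?S \<inter> ?Q"
  proof -
    have "?c (Var i * 0) = ?c 0" for i by simp
    then have "?c 0 \<in> ?S" unfolding socle_def by blast
    moreover have "?c 0 \<in> ?Q" unfolding quotient_component_def by (rule imageI) simp
    ultimately show ?thesis by blast
  qed
qed

lemma grid_socle_bound:
  assumes ab: "2 \<le> a" "a \<le> b" and grid: "is_grid a b G" and \<rho>: "coord_choice G \<rho>"
    and d: "2 \<le> d" "d = (b - 1) * q + r" "r < b - 1" and t: "t + 2 \<le> d + q"
    and f: "f \<in> homog t" "\<And>i. Var i * f \<in> Lambda \<rho> G d"
  shows "f \<in> Lambda \<rho> (G :: ('k::field_char_0 ^ 4) set set) d"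
proof -
  obtain A where G: "finite G" "card G = a * b" "\<forall>P\<in>G. \<rho> P \<noteq> 0" "separates G \<rho> (b - 1)"
    and A: "transpose A = A" "invertible A" "\<forall>P\<in>G. pairing (\<rho> P) (A *v \<rho> P) = 0"
    using grid_properties[OF ab grid \<rho>] .
  have comb: "Var i * f \<in> power_comb G \<rho> d (t + 2 - d)" for i
  proof -
    have "Var i * f \<in> component (Lambda \<rho> G d) (Suc t)"
      using f(2) homog_mult[OF Var_homog f(1)] by (simp add: component_def)
    then show ?thesis by (simp add: component_Lambda_eq[OF G(1)])
  qed
  show ?thesis
  proof (cases "t + 2 < d")
    case True
    \<comment> \<open>\<open>Var 1 * f\<close> lies in a degree below \<open>d\<close>, where the
      ideal is zero.\<close>
    then have "Var 1 * f = 0" using comb[of 1] by simp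
    then show ?thesis using Lambda_closed(1)[OF G(1)] by simp
  next
    case False
    then obtain m where m: "t + 2 = d + m" by (metis le_add_diff_inverse linorder_not_less)
    then have "m \<le> q" using t by simp
    have comb: "Var i * f \<in> power_comb G \<rho> d m" for i
      using comb[of i] m by simp
    have "m * (b - 1) \<le> q * (b - 1)" using \<open>m \<le> q\<close> by (rule mult_le_mono1)
    then have mc: "m * (b - 1) \<le> d" using d(2) mult.commute[of q "b - 1"] by linarith
    \<comment> \<open>The only case in which the inequality behind the integration fails; then a = b
      = 2 and the four points are independent.\<close>
    show ?thesis
    proof (cases "b = 2 \<and> m = d")
      case True
      then have "a = 2" using ab by simp
      then have "card G = 4" using G(2) True by simp
      have "separates G \<rho> 1" using G(4) True by simp
      then obtain h where "dual_system G \<rho> h" by (rule separates_one_dual_system)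
      then have "\<exists>g. f = (\<Sum>P\<in>G. g P * dual_form (\<rho> P) ^ d)"
        using four_points_Var_mult[OF G(1) \<open>card G = 4\<close> _ f(1) m comb d(1)] m True by simp
      then show ?thesis by (auto simp: Lambda_eq[OF G(1)])
    next
      case False
      have "m < d \<and> (\<forall>k. k + 2 \<le> m \<longrightarrow> (m - 1 - k) * (b - 1) + k + 2 \<le> d)"
      proof (cases "b = 2")
        case True
        then have "m < d" using mc False by simp
        then show ?thesis using True by auto
      next
        case b: False
        then have c: "2 \<le> b - 1" using ab by simp
        have "m * 2 \<le> m * (b - 1)" using c by (rule mult_le_mono2)
        then have "m * 2 \<le> d" using mc by (rule le_trans)
        then have "m < d" using d(1) by linarith
        moreover have "(m - 1 - k) * (b - 1) + k + 2 \<le> d" if k: "k + 2 \<le> m" for k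
        proof -
          have "(k + 1) * 2 \<le> (k + 1) * (b - 1)" using c by (rule mult_le_mono2)
          \<comment> \<open>Since b - 1 \<ge> 2, the \<open>k + 1\<close> copies of
            \<open>b - 1\<close> missing from \<open>m * (b - 1)\<close> make up for
            \<open>k + 2\<close>.\<close>
          then have "(m - 1 - k) * (b - 1) + k + 2 \<le> (m - 1 - k) * (b - 1) + (k + 1) * (b - 1)" by simp
          also have "\<dots> = (m - 1 - k + (k + 1)) * (b - 1)" by (rule distrib_right[symmetric])
          also have "m - 1 - k + (k + 1) = m" using k by simp
          finally show ?thesis using mc by simp
        qed
        ultimately show ?thesis by blast
      qed
      then have "f \<in> power_comb G \<rho> d (m - 1)"
        using power_comb_of_Var_mult[OF G(1,4,3) A(1,3,2) f(1) m comb] by blast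
      then show ?thesis using power_comb_subset_Lambda[OF G(1)] by blast
    qed
  qed
qed

theorem corollary5p2:
  fixes G :: "('k::field_char_0 ^ 4) set set"
    and \<rho> :: "('k ^ 4) set \<Rightarrow> 'k ^ 4"
    and I :: "'k poly4 set"
    and a b d q r :: nat
  assumes "2 \<le> a" and "a \<le> b"
    and "is_grid a b G"
    and "coord_choice G \<rho>"
    and "b - 1 \<le> d"
    and "I = Lambda \<rho> G d"
    and "d = (b - 1) * q + r" and "r < b - 1"
  shows "(\<forall>t. d \<le> t \<and> t \<le> d + q - 1 \<longrightarrow>
            component I t = subspace_prod (homog (t - d)) (component I d) \<and>
            poly4.dim (component I t) = a * b * ((t - d + 3) choose 3))
       \<and> (\<forall>j g. j \<le> q - 1 \<and> (\<forall>P\<in>G. g P \<in> homog j) \<and>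
            (\<Sum>P\<in>G. g P * dual_form (\<rho> P) ^ d) = 0 \<longrightarrow> (\<forall>P\<in>G. g P = 0))
       \<and> (2 \<le> d \<longrightarrow>
            (\<forall>t \<le> d + q - 2. socle I \<inter> quotient_component I t = {residue_class I 0}))"
proof -
  obtain A where G: "finite G" "card G = a * b" "\<forall>P\<in>G. \<rho> P \<noteq> 0" "separates G \<rho> (b - 1)"
    and "transpose A = A" "invertible A" "\<forall>P\<in>G. pairing (\<rho> P) (A *v \<rho> P) = 0"
    using grid_properties[OF assms(1-4)] .
  have "q \<noteq> 0" using assms(5,7,8) by (intro notI) simp
  have unique: "\<forall>P\<in>G. g P = 0"
    if "j \<le> q - 1 \<and> (\<forall>P\<in>G. g P \<in> homog j) \<and> (\<Sum>P\<in>G. g P * dual_form (\<rho> P) ^ d) = 0" for j g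
  proof
    fix P assume P: "P \<in> G"
    \<comment> \<open>Degree \<open>j\<close> corresponds to index \<open>Suc j\<close>, which is at
      most \<open>q\<close>.\<close>
    have "Suc j * (b - 1) \<le> q * (b - 1)"
      using that \<open>q \<noteq> 0\<close> by (intro mult_le_mono1) linarith
    then have "Suc j * (b - 1) \<le> d" using assms(7) mult.commute[of q "b - 1"] by linarith
    moreover have "\<forall>P\<in>G. g P \<in> homog_pred (Suc j)" using that by simp
    ultimately show "g P = 0"
      using power_comb_unique[OF G(1,4) _ _ G(3) _ P] that by blast
  qed
  have components: "component I t = subspace_prod (homog (t - d)) (component I d) \<and>
      poly4.dim (component I t) = a * b * ((t - d + 3) choose 3)" if t: "d \<le> t \<and> t \<le> d + q - 1" for t
  proof
    show "component I t = subspace_prod (homog (t - d)) (component I d)"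
      unfolding assms(6) using G(1) conjunct1[OF t] by (rule component_eq_subspace_prod)
    have "t - d \<le> q - 1" using t \<open>q \<noteq> 0\<close> by linarith
    have "component I t = power_comb G \<rho> d (Suc (t - d))"
      using t by (simp add: assms(6) component_Lambda_eq[OF G(1)] Suc_diff_le)
    then show "poly4.dim (component I t) = a * b * ((t - d + 3) choose 3)"
      using dim_power_comb[OF G(1) unique, of "t - d"] \<open>t - d \<le> q - 1\<close> G(2) by simp
  qed
  have socle: "socle I \<inter> quotient_component I t = {residue_class I 0}" if "2 \<le> d" "t \<le> d + q - 2" for t
    unfolding assms(6)
  proof (rule socle_component_zero[OF G(1)])
    have "t + 2 \<le> d + q" using that by simp
    then show "f \<in> Lambda \<rho> G d" if "f \<in> homog t" "\<And>i. Var i * f \<in> Lambda \<rho> G d" for f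
      using grid_socle_bound[OF assms(1-4) \<open>2 \<le> d\<close> assms(7,8) _ that] by blast
  qed
  show ?thesis
    by (rule conjI, intro allI impI, erule components,
        rule conjI, intro allI impI, erule unique, intro allI impI, erule (1) socle)
qed

end
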